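(* Let $n\ge 4$ be even (so that $n+1$ is odd), let $W=W(D_{n+1})$ be the Coxeter group of type $D_{n+1}$ with longest element $w_o$, and let $W_o\subset W$ be the subgroup of elements commuting with $w_o$. For integers $l\in\{0,\dots,n\}$ and $k\in\{0,\dots,\lfloor (n-l)/2\rfloor\}$ let $$I_{k,l}=\{2i-1 : 1\le i\le k\}\cup J_l\subset\{1,\dots,n+1\},\qquad J_0=\emptyset,\quad J_l=\{n+1-l,\dots,n+1\}\ \text{ for } l>0,$$ and $c_{k,l}:=w_{I_{k,l}}$. Then each $c_{k,l}$ is an involution in $W_o$; each involution in $W_o$ is conjugate in $W_o$ to precisely one of the involutions $c_{k,l}$; and for all such $k,l$ the element $w_o c_{k,l}$ is conjugate in $W_o$ to $c_{k,\,n-2k-l}$.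
   Context: The Coxeter graph $D_{n+1}$ has nodes $1,\dots,n+1$; nodes $1,\dots,n-1$ form a path in this order, and nodes $n$ and $n+1$ are the two further nodes, each joined (only) to node $n-1$; all edges have label $3$. Node $i$ corresponds to the simple generator $s_i$. For a set of nodes $I$, $W_I$ denotes the parabolic subgroup generated by $\{s_i: i\in I\}$, and $w_I$ denotes its longest element. An involution is an element $x$ with $x^2=1$ (the identity is included). *)

theory Defs
  imports "HOL-Algebra.Generated_Groups"
begin

section \<open>Coxeter groups by generators and relations\<close>

text \<open>
  A Coxeter matrix on a set \<open>S\<close> of generators is given as a function \<open>m\<close>; it is meant to
  be symmetric with \<open>m s s = 1\<close> and \<open>m s t \<ge> 2\<close> for \<open>s \<noteq> t\<close>. The value \<open>0\<close> stands for
  \<open>\<infinity>\<close>: the relator \<open>(s t) ^ 0\<close> is then the empty word.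
  Because every generator is self-inverse (relator \<open>s s\<close>), the group presented by these
  relators is the quotient of the free monoid of words over \<open>S\<close> by the least congruence
  that makes all relators trivial.
\<close>

inductive cox_equiv :: "'s set \<Rightarrow> ('s \<Rightarrow> 's \<Rightarrow> nat) \<Rightarrow> 's list \<Rightarrow> 's list \<Rightarrow> bool"
  for S :: "'s set" and m :: "'s \<Rightarrow> 's \<Rightarrow> nat" where
  refl: "u \<in> lists S \<Longrightarrow> cox_equiv S m u u"
| sym: "cox_equiv S m u v \<Longrightarrow> cox_equiv S m v u"
| trans: "cox_equiv S m u v \<Longrightarrow> cox_equiv S m v w \<Longrightarrow> cox_equiv S m u w"
| cong: "cox_equiv S m u u' \<Longrightarrow> cox_equiv S m v v' \<Longrightarrow> cox_equiv S m (u @ v) (u' @ v')"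
| relator: "s \<in> S \<Longrightarrow> t \<in> S \<Longrightarrow> cox_equiv S m (concat (replicate (m s t) [s, t])) []"

definition cox_rel :: "'s set \<Rightarrow> ('s \<Rightarrow> 's \<Rightarrow> nat) \<Rightarrow> ('s list \<times> 's list) set" where
  "cox_rel S m = {(u, v). cox_equiv S m u v}"

definition cox_class :: "'s set \<Rightarrow> ('s \<Rightarrow> 's \<Rightarrow> nat) \<Rightarrow> 's list \<Rightarrow> 's list set" where
  "cox_class S m u = cox_rel S m `` {u}"

definition coxeter_group :: "'s set \<Rightarrow> ('s \<Rightarrow> 's \<Rightarrow> nat) \<Rightarrow> 's list set monoid" where
  "coxeter_group S m =
     \<lparr>carrier = lists S // cox_rel S m,
      mult = (\<lambda>A B. \<Union>u\<in>A. \<Union>v\<in>B. cox_class S m (u @ v)),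
      one = cox_class S m []\<rparr>"

definition cox_gen :: "'s set \<Rightarrow> ('s \<Rightarrow> 's \<Rightarrow> nat) \<Rightarrow> 's \<Rightarrow> 's list set" where
  "cox_gen S m s = cox_class S m [s]"

text \<open>The elements of \<open>coxeter_group S m\<close> are the classes of words, so the words
  representing an element are exactly its members.\<close>

definition cox_length :: "'s list set \<Rightarrow> nat" where
  "cox_length x = (LEAST k. \<exists>u\<in>x. length u = k)"

definition parabolic :: "'s set \<Rightarrow> ('s \<Rightarrow> 's \<Rightarrow> nat) \<Rightarrow> 's set \<Rightarrow> 's list set set" where
  "parabolic S m I = generate (coxeter_group S m) (cox_gen S m ` I)"

definition longest_element :: "'s set \<Rightarrow> ('s \<Rightarrow> 's \<Rightarrow> nat) \<Rightarrow> 's set \<Rightarrow> 's list set" where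
  "longest_element S m I =
     (THE w. w \<in> parabolic S m I \<and> (\<forall>v\<in>parabolic S m I. cox_length v \<le> cox_length w))"

lemma cox_equiv_lists: "cox_equiv S m u v \<Longrightarrow> u \<in> lists S \<and> v \<in> lists S"
proof (induction rule: cox_equiv.induct)
  case (relator s t)
  have "concat (replicate k [s, t]) \<in> lists S" for k
    by (induction k) (simp_all add: relator)
  then show ?case by simp
qed simp_all

lemma equiv_cox_rel: "equiv (lists S) (cox_rel S m)"
proof (rule equivI)
  show "cox_rel S m \<subseteq> lists S \<times> lists S"
    unfolding cox_rel_def by (blast dest: cox_equiv_lists)
  show "refl_on (lists S) (cox_rel S m)"
    by (simp add: refl_on_def cox_rel_def cox_equiv.refl)
  show "sym (cox_rel S m)"
    by (simp add: sym_def cox_rel_def cox_equiv.sym)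
  show "trans (cox_rel S m)"
    unfolding trans_def cox_rel_def by (blast intro: cox_equiv.trans)
qed

lemma cox_class_eq_iff:
  assumes "u \<in> lists S" "v \<in> lists S"
  shows "cox_class S m u = cox_class S m v \<longleftrightarrow> cox_equiv S m u v"
  using eq_equiv_class_iff[OF equiv_cox_rel assms]
  by (simp add: cox_class_def cox_rel_def)

lemma carrier_coxeter_group: "carrier (coxeter_group S m) = cox_class S m ` lists S"
  by (auto simp: coxeter_group_def quotient_def cox_class_def)

lemma one_coxeter_group: "\<one>\<^bsub>coxeter_group S m\<^esub> = cox_class S m []"
  by (simp add: coxeter_group_def)

lemma mult_coxeter_group:
  assumes "u \<in> lists S" "v \<in> lists S"
  shows "cox_class S m u \<otimes>\<^bsub>coxeter_group S m\<^esub> cox_class S m v = cox_class S m (u @ v)"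
proof -
  have "cox_class S m (u' @ v') = cox_class S m (u @ v)"
    if "u' \<in> cox_class S m u" "v' \<in> cox_class S m v" for u' v'
  proof -
    have e: "cox_equiv S m u u'" "cox_equiv S m v v'"
      using that by (auto simp: cox_class_def cox_rel_def)
    then have "cox_equiv S m (u' @ v') (u @ v)"
      by (rule cox_equiv.sym[OF cox_equiv.cong])
    then show ?thesis
      using cox_equiv_lists[OF e(1)] cox_equiv_lists[OF e(2)] by (simp add: cox_class_eq_iff)
  qed
  moreover have "u \<in> cox_class S m u" "v \<in> cox_class S m v"
    using assms by (simp_all add: cox_class_def cox_rel_def cox_equiv.refl)
  ultimately have "(\<Union>u'\<in>cox_class S m u. \<Union>v'\<in>cox_class S m v. cox_class S m (u' @ v'))
      = cox_class S m (u @ v)"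
    by blast
  then show ?thesis
    by (simp add: coxeter_group_def)
qed

lemma group_coxeter_group:
  assumes "\<And>s. s \<in> S \<Longrightarrow> m s s = 1"
  shows "group (coxeter_group S m)"
proof (rule groupI)
  fix x assume "x \<in> carrier (coxeter_group S m)"
  then obtain u where u: "u \<in> lists S" "x = cox_class S m u"
    by (auto simp: carrier_coxeter_group)
  have "cox_equiv S m (rev u @ u) []"
    using u(1)
  proof (induction u)
    case (Cons s u)
    have "cox_equiv S m [s, s] []"
      using cox_equiv.relator[of s S s m] assms[of s] Cons.hyps by simp
    then have "cox_equiv S m (rev u @ ([s, s] @ u)) (rev u @ ([] @ u))"
      using Cons.hyps by (intro cox_equiv.cong cox_equiv.refl) auto
    then show ?case
      using Cons.IH cox_equiv.trans[of S m _ "rev u @ u" "[]"] by simp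
  qed (simp add: cox_equiv.refl)
  then have "cox_class S m (rev u) \<otimes>\<^bsub>coxeter_group S m\<^esub> x = \<one>\<^bsub>coxeter_group S m\<^esub>"
    using u by (simp add: mult_coxeter_group one_coxeter_group cox_class_eq_iff in_lists_conv_set)
  moreover have "cox_class S m (rev u) \<in> carrier (coxeter_group S m)"
    using u by (auto simp: carrier_coxeter_group)
  ultimately show "\<exists>y\<in>carrier (coxeter_group S m).
      y \<otimes>\<^bsub>coxeter_group S m\<^esub> x = \<one>\<^bsub>coxeter_group S m\<^esub>" by blast
qed (unfold carrier_coxeter_group one_coxeter_group,
    ((elim imageE)?, simp add: mult_coxeter_group)+)


section \<open>Involutions, centralizers and conjugacy in a subgroup\<close>

definition is_involution :: "('a, 'b) monoid_scheme \<Rightarrow> 'a \<Rightarrow> bool" where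
  "is_involution G x \<longleftrightarrow> x \<in> carrier G \<and> x \<otimes>\<^bsub>G\<^esub> x = \<one>\<^bsub>G\<^esub>"

definition centralizer_of :: "('a, 'b) monoid_scheme \<Rightarrow> 'a \<Rightarrow> 'a set" where
  "centralizer_of G z = {x \<in> carrier G. x \<otimes>\<^bsub>G\<^esub> z = z \<otimes>\<^bsub>G\<^esub> x}"

definition conjugate_in :: "('a, 'b) monoid_scheme \<Rightarrow> 'a set \<Rightarrow> 'a \<Rightarrow> 'a \<Rightarrow> bool" where
  "conjugate_in G H x y \<longleftrightarrow>
     x \<in> H \<and> y \<in> H \<and> (\<exists>g\<in>H. y = g \<otimes>\<^bsub>G\<^esub> x \<otimes>\<^bsub>G\<^esub> inv\<^bsub>G\<^esub> g)"


section \<open>Type D\<close>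

text \<open>The Coxeter graph \<open>D\<^sub>r\<close> (\<open>r \<ge> 4\<close>): nodes \<open>1, \<dots>, r\<close>, a path on \<open>1, \<dots>, r - 2\<close>,
  and the two nodes \<open>r - 1\<close> and \<open>r\<close>, each joined to \<open>r - 2\<close> only.\<close>

definition D_nodes :: "nat \<Rightarrow> nat set" where
  "D_nodes r = {1..r}"

definition D_edges :: "nat \<Rightarrow> nat set set" where
  "D_edges r = {{i, i + 1} | i. 1 \<le> i \<and> i + 1 \<le> r - 2} \<union> {{r - 2, r - 1}, {r - 2, r}}"

definition D_matrix :: "nat \<Rightarrow> nat \<Rightarrow> nat \<Rightarrow> nat" where
  "D_matrix r i j = (if i = j then 1 else if {i, j} \<in> D_edges r then 3 else 2)"

definition W_D :: "nat \<Rightarrow> nat list set monoid" where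
  "W_D r = coxeter_group (D_nodes r) (D_matrix r)"

definition longest_D :: "nat \<Rightarrow> nat set \<Rightarrow> nat list set" where
  "longest_D r I = longest_element (D_nodes r) (D_matrix r) I"

definition J_set :: "nat \<Rightarrow> nat \<Rightarrow> nat set" where
  "J_set n l = (if l = 0 then {} else {n + 1 - l..n + 1})"

definition I_set :: "nat \<Rightarrow> nat \<Rightarrow> nat \<Rightarrow> nat set" where
  "I_set n k l = {2 * i - 1 | i. 1 \<le> i \<and> i \<le> k} \<union> J_set n l"

definition KL_indices :: "nat \<Rightarrow> (nat \<times> nat) set" where
  "KL_indices n = {(k, l). l \<le> n \<and> k \<le> (n - l) div 2}"

end

(*
  W(D_r), r = n + 1, acts faithfully by even signed permutations of {-r..r}. Faithfulness, the
  length formula (number of inversions) and the recognition of longest elements all follow from one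
  simultaneous induction on the length of a word u: if u sends a simple root alpha_t to a negative
  root, then u is equivalent to a word v t with v shorter, and if u alpha_t = alpha_s, then u t is
  equivalent to s u.

  For r odd, w_o is -1 on the coordinates 1..n and fixes r, so its centralizer consists of the x
  with x r = r or x r = -r, and x is determined by its restriction to the coordinates 1..n. Hence
  conjugacy of involutions in the centralizer is conjugacy of signed permutations of 1..n: the
  number of coordinates moved up to sign and the number of negated coordinates form a complete set
  of invariants. They are 2k and l for c_{k,l}, and 2k and n - 2k - l for w_o c_{k,l}.
*)

theory Submission
  imports Defs
begin

section \<open>Coxeter groups\<close>

text \<open>The obstacle in the centralizer is parity. A signed permutation of 1..n that conjugates
  two involutions may change an odd number of signs, and then it does not extend to an element of W
  fixing r. Elements of the centralizer may, however, negate r, and this absorbs the parity: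
  restriction to 1..n reaches every signed permutation. So the centralizer behaves as type B_n,
  where no parity condition refines the count of moved and negated coordinates. Evenness of n enters
  because -1 on 1..n must have an even number of sign changes to lie in W.

  The index sets are made for this. J_l involves the coordinates n+1-l..n+1 and is of type D_(l+1).
  Its longest element is -1 on all of them if l is odd, and fixes coordinate n+1 if l is even; in
  both cases exactly l of the coordinates 1..n are negated. The nodes 1,3,..,2k-1 contribute k
  disjoint transpositions of coordinates up to 2k, and 2k <= n-l keeps the two parts apart.\<close>

text \<open>Generators are their own inverses, so closing under inverses adds nothing to the words
  over \<open>I\<close>.\<close>

lemma cox_class_parabolic:
  assumes "I \<subseteq> S" and m1: "\<And>s. s \<in> S \<Longrightarrow> m s s = 1"
  shows "parabolic S m I = cox_class S m ` lists I"
proof -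
  interpret group "coxeter_group S m" using m1 by (rule group_coxeter_group)
  have sub: "u \<in> lists S" if "u \<in> lists I" for u using that assms(1) by auto
  show ?thesis
  proof (intro equalityI subsetI)
    fix x assume "x \<in> parabolic S m I"
    then show "x \<in> cox_class S m ` lists I"
      unfolding parabolic_def
    proof (induction rule: generate.induct)
      case one
      then show ?case by (auto simp: one_coxeter_group)
    next
      case (incl h)
      then show ?case by (auto simp: cox_gen_def)
    next
      case (inv h)
      then obtain s where s: "s \<in> I" "h = cox_class S m [s]" by (auto simp: cox_gen_def)
      then have sS: "s \<in> S" using assms(1) by auto
      have "cox_equiv S m [s, s] []" using cox_equiv.relator[of s S s m] sS m1[of s] by simp
      then have "h \<otimes>\<^bsub>coxeter_group S m\<^esub> h = \<one>\<^bsub>coxeter_group S m\<^esub>"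
        using s sS by (simp add: mult_coxeter_group one_coxeter_group cox_class_eq_iff)
      moreover have "h \<in> carrier (coxeter_group S m)"
        using s sS by (auto simp: carrier_coxeter_group)
      ultimately have "inv\<^bsub>coxeter_group S m\<^esub> h = h" by (intro inv_equality)
      then show ?case using s by auto
    next
      case (eng h1 h2)
      then obtain u v where "u \<in> lists I" "v \<in> lists I" "h1 = cox_class S m u" "h2 = cox_class S m v"
        by auto
      then show ?case
        by (metis append_in_lists_conv image_eqI mult_coxeter_group sub)
    qed
  next
    fix x assume "x \<in> cox_class S m ` lists I"
    then obtain u where u: "u \<in> lists I" "x = cox_class S m u" by auto
    have "cox_class S m u \<in> generate (coxeter_group S m) (cox_gen S m ` I)"
      using u(1)
    proof (induction u)
      case Nil
      then show ?case using generate.one by (simp flip: one_coxeter_group)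
    next
      case (Cons s u)
      have "cox_class S m (s # u) = cox_gen S m s \<otimes>\<^bsub>coxeter_group S m\<^esub> cox_class S m u"
        using Cons.hyps assms(1) sub[OF Cons.hyps(2)]
        by (subst cox_gen_def, subst mult_coxeter_group) auto
      then show ?case using Cons by (auto intro: generate.intros)
    qed
    then show "x \<in> parabolic S m I" using u by (simp add: parabolic_def)
  qed
qed

lemma foldr_closed:
  assumes "\<And>s x. s \<in> S \<Longrightarrow> x \<in> X \<Longrightarrow> act s x \<in> X" and "u \<in> lists S" and "x \<in> X"
  shows "foldr act u x \<in> X"
  using assms(2) by (induction u) (auto simp: assms)

text \<open>Trivial action of the relators is all that is needed to descend to the presented group.
  The domain \<open>X\<close> is kept general because the lemma serves twice: for roots, and for all
  integers as signed coordinates.\<close>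

lemma foldr_cox_equiv:
  assumes "cox_equiv S m u v"
    and cl: "\<And>s x. s \<in> S \<Longrightarrow> x \<in> X \<Longrightarrow> act s x \<in> X"
    and rel: "\<And>s t x. s \<in> S \<Longrightarrow> t \<in> S \<Longrightarrow> x \<in> X \<Longrightarrow>
      foldr act (concat (replicate (m s t) [s, t])) x = x"
    and "x \<in> X"
  shows "foldr act u x = foldr act v x"
  using assms(1,4)
proof (induction arbitrary: x rule: cox_equiv.induct)
  case (cong u u' v v')
  have "v \<in> lists S" "u \<in> lists S" using cong.hyps cox_equiv_lists by blast+
  then have "foldr act v x \<in> X" using foldr_closed[of S X act] cl cong.prems by blast
  then show ?case using cong by simp
qed (auto simp: rel)

text \<open>An action of a simply laced Coxeter group on a system of roots that are told positive from
  negative by a height function. Simple roots have height 1, so a sum of two positive roots is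
  never simple; this replaces all linear algebra below.\<close>

locale simply_laced_action =
  fixes S :: "'s set" and m :: "'s \<Rightarrow> 's \<Rightarrow> nat" and R :: "'r set"
    and neg :: "'r \<Rightarrow> 'r" and act :: "'s \<Rightarrow> 'r \<Rightarrow> 'r" and root :: "'s \<Rightarrow> 'r" and ht :: "'r \<Rightarrow> int"
  assumes finite_R: "finite R"
    and m_diag: "\<And>s. s \<in> S \<Longrightarrow> m s s = 1"
    and m_off_diag: "\<And>s t. \<lbrakk>s \<in> S; t \<in> S; s \<noteq> t\<rbrakk> \<Longrightarrow> m s t = 2 \<or> m s t = 3"
    and inj_root: "inj_on root S"
    and root_R: "\<And>s. s \<in> S \<Longrightarrow> root s \<in> R"
    and ht_root: "\<And>s. s \<in> S \<Longrightarrow> ht (root s) = 1"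
    and ht_nonzero: "\<And>\<beta>. \<beta> \<in> R \<Longrightarrow> ht \<beta> \<noteq> 0"
    and neg_R: "\<And>\<beta>. \<beta> \<in> R \<Longrightarrow> neg \<beta> \<in> R"
    and neg_neg: "\<And>\<beta>. \<beta> \<in> R \<Longrightarrow> neg (neg \<beta>) = \<beta>"
    and ht_neg: "\<And>\<beta>. \<beta> \<in> R \<Longrightarrow> ht (neg \<beta>) = - ht \<beta>"
    and act_R: "\<And>s \<beta>. \<lbrakk>s \<in> S; \<beta> \<in> R\<rbrakk> \<Longrightarrow> act s \<beta> \<in> R"
    and act_neg: "\<And>s \<beta>. \<lbrakk>s \<in> S; \<beta> \<in> R\<rbrakk> \<Longrightarrow> act s (neg \<beta>) = neg (act s \<beta>)"
    and act_act: "\<And>s \<beta>. \<lbrakk>s \<in> S; \<beta> \<in> R\<rbrakk> \<Longrightarrow> act s (act s \<beta>) = \<beta>"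
    and act_root: "\<And>s. s \<in> S \<Longrightarrow> act s (root s) = neg (root s)"
    and act_relator: "\<And>s t \<beta>. \<lbrakk>s \<in> S; t \<in> S; \<beta> \<in> R\<rbrakk> \<Longrightarrow>
      foldr act (concat (replicate (m s t) [s, t])) \<beta> = \<beta>"
    and root_if_negated: "\<And>s \<beta>. \<lbrakk>s \<in> S; \<beta> \<in> R; 0 < ht \<beta>; ht (act s \<beta>) < 0\<rbrakk> \<Longrightarrow> \<beta> = root s"
    and act_root_2: "\<And>s t. \<lbrakk>s \<in> S; t \<in> S; m s t = 2\<rbrakk> \<Longrightarrow> act s (root t) = root t"
    and act_root_3: "\<And>s t. \<lbrakk>s \<in> S; t \<in> S; m s t = 3\<rbrakk> \<Longrightarrow> act t (act s (root t)) = root s"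
    and ht_act_root_3: "\<And>s t u. \<lbrakk>s \<in> S; t \<in> S; m s t = 3; u \<in> lists S\<rbrakk> \<Longrightarrow>
      ht (foldr act u (act s (root t))) = ht (foldr act u (root s)) + ht (foldr act u (root t))"
begin

section \<open>Calculus of words modulo the Coxeter relations\<close>

abbreviation equ (infix "\<approx>" 50) where "u \<approx> v \<equiv> cox_equiv S m u v"

declare cox_equiv.trans [trans]

lemma act_cong: "u \<approx> v \<Longrightarrow> \<beta> \<in> R \<Longrightarrow> foldr act u \<beta> = foldr act v \<beta>"
  using foldr_cox_equiv[of S m u v R act \<beta>] act_R act_relator by blast

lemma foldr_act_R: "u \<in> lists S \<Longrightarrow> \<beta> \<in> R \<Longrightarrow> foldr act u \<beta> \<in> R"
  using foldr_closed[of S R act] act_R by blast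

lemma foldr_act_neg: "u \<in> lists S \<Longrightarrow> \<beta> \<in> R \<Longrightarrow> foldr act u (neg \<beta>) = neg (foldr act u \<beta>)"
  by (induction u) (auto simp: act_neg foldr_act_R)

lemma foldr_act_rev: "u \<in> lists S \<Longrightarrow> \<beta> \<in> R \<Longrightarrow> foldr act u (foldr act (rev u) \<beta>) = \<beta>"
  by (induction u arbitrary: \<beta>) (auto simp: act_R act_act)

lemma equ_append_left: "x \<in> lists S \<Longrightarrow> u \<approx> v \<Longrightarrow> x @ u \<approx> x @ v"
  by (intro cox_equiv.cong cox_equiv.refl)

lemma equ_append_right: "x \<in> lists S \<Longrightarrow> u \<approx> v \<Longrightarrow> u @ x \<approx> v @ x"
  by (intro cox_equiv.cong cox_equiv.refl)

lemma equ_square: "s \<in> S \<Longrightarrow> [s, s] \<approx> []"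
  using cox_equiv.relator[of s S s m] m_diag[of s] by simp

lemma equ_cancel_right:
  assumes "u @ x \<approx> v @ x" "u \<in> lists S" "v \<in> lists S" "x \<in> lists S"
  shows "u \<approx> v"
  using assms
proof (induction x arbitrary: u v)
  case Nil
  then show ?case by simp
next
  case (Cons s x)
  have "(u @ [s]) @ x \<approx> (v @ [s]) @ x" using Cons.prems by simp
  then have "u @ [s] \<approx> v @ [s]" using Cons.prems by - (rule Cons.IH; auto)
  then have *: "(u @ [s]) @ [s] \<approx> (v @ [s]) @ [s]" using Cons.prems by - (rule equ_append_right; auto)
  have cancel: "w @ [s, s] \<approx> w" if "w \<in> lists S" for w
    using equ_append_left[OF that equ_square, of s] Cons.prems by simp
  have "u \<approx> u @ [s, s]" using cancel Cons.prems by (intro cox_equiv.sym[OF cancel])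
  also have "u @ [s, s] \<approx> v @ [s, s]" using * by simp
  also have "v @ [s, s] \<approx> v" using cancel Cons.prems by blast
  finally show ?case .
qed

text \<open>The words \<open>[s, t] @ [s, t]\<close> and \<open>[t, s] @ [s, t]\<close> are both
  trivial, the first by the relator and the second by squares; their common right part cancels.
  \<open>equ_braid_3\<close> is the same argument with three letters.\<close>

lemma equ_braid_2:
  assumes "s \<in> S" "t \<in> S" "m s t = 2"
  shows "[s, t] \<approx> [t, s]"
proof -
  have "[s, t] @ [s, t] \<approx> []"
    using cox_equiv.relator[of s S t m] assms by (simp add: numeral_2_eq_2)
  also have "[] \<approx> [t, s, s, t]"
  proof (rule cox_equiv.sym)
    have "[t] @ [s, s] @ [t] \<approx> [t] @ [] @ [t]"
      using assms by (intro equ_append_left equ_append_right equ_square) auto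
    also have "[t] @ [] @ [t] \<approx> []" using equ_square[OF assms(2)] by simp
    finally show "[t, s, s, t] \<approx> []" by simp
  qed
  finally have "[s, t] @ [s, t] \<approx> [t, s] @ [s, t]" by simp
  then show ?thesis using equ_cancel_right assms by auto
qed

lemma equ_braid_3:
  assumes "s \<in> S" "t \<in> S" "m s t = 3"
  shows "[t, s, t] \<approx> [s, t, s]"
proof -
  have "[s, t, s] @ [t, s, t] \<approx> []"
    using cox_equiv.relator[of s S t m] assms by (simp add: numeral_3_eq_3)
  also have "[] \<approx> [t, s, t, t, s, t]"
  proof (rule cox_equiv.sym)
    have "[t, s] @ [t, t] @ [s, t] \<approx> [t, s] @ [] @ [s, t]"
      using assms by (intro equ_append_left equ_append_right equ_square) auto
    also have "[t, s] @ [] @ [s, t] = [t] @ [s, s] @ [t]" by simp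
    also have "[t] @ [s, s] @ [t] \<approx> [t] @ [] @ [t]"
      using assms by (intro equ_append_left equ_append_right equ_square) auto
    also have "[t] @ [] @ [t] \<approx> []" using equ_square[OF assms(2)] by simp
    finally show "[t, s, t, t, s, t] \<approx> []" by simp
  qed
  finally have "[s, t, s] @ [t, s, t] \<approx> [t, s, t] @ [t, s, t]" by simp
  then have "[s, t, s] \<approx> [t, s, t]" by (rule equ_cancel_right) (use assms in auto)
  then show ?thesis by (rule cox_equiv.sym)
qed

section \<open>The exchange property\<close>

lemma negated_split:
  assumes "u \<in> lists S" "\<beta> \<in> R" "0 < ht \<beta>" "ht (foldr act u \<beta>) < 0"
  obtains x s y where "u = x @ s # y" "foldr act y \<beta> = root s"
  using assms
proof (induction u arbitrary: thesis)
  case Nil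
  then show ?case by simp
next
  case (Cons a u)
  show ?case
  proof (cases "ht (foldr act u \<beta>) < 0")
    case True
    with Cons obtain x s y where "u = x @ s # y" "foldr act y \<beta> = root s" by auto
    then show ?thesis using Cons.prems(1)[of "a # x"] by simp
  next
    case False
    then have "0 < ht (foldr act u \<beta>)"
      using ht_nonzero[of "foldr act u \<beta>"] foldr_act_R[of u \<beta>] Cons by force
    \<comment> \<open>Here the letter \<open>a\<close> turns a positive root negative, and it does
      that only to its own simple root.\<close>
    then have "foldr act u \<beta> = root a"
      using Cons foldr_act_R[of u \<beta>] by (intro root_if_negated) auto
    then show ?thesis using Cons.prems(1)[of "[]"] by simp
  qed
qed

text \<open>Replaces \<open>u\<close> by an equivalent shorter word, to which the induction
  hypothesis of the next lemma applies.\<close>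

lemma equ_conj_via_shorter:
  assumes u: "u \<approx> v" and st: "s \<in> S" "t \<in> S" and v: "v @ [t] \<approx> s # v"
  shows "u @ [t] \<approx> s # u"
proof -
  have "u @ [t] \<approx> v @ [t]" using u st by - (rule equ_append_right; auto)
  also note v
  also have "s # v \<approx> s # u"
    using equ_append_left[of "[s]" v u] u st by (auto intro: cox_equiv.sym)
  finally show ?thesis .
qed

text \<open>Each claim uses the other at smaller length. If \<open>u\<close> negates the root of
  \<open>t\<close>, cut it as \<open>x @ s # y\<close> where \<open>y\<close> takes the root of
  \<open>t\<close> to that of \<open>s\<close>; the second claim for \<open>y\<close> turns
  \<open>y @ [t]\<close> into \<open>s # y\<close>, so \<open>u\<close> is equivalent to
  \<open>(x @ y) @ [t]\<close>, with \<open>s\<close> deleted. For the second claim, the last letter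
  \<open>r\<close> of \<open>u\<close> and the letter \<open>t\<close> span a rank two group, inside
  which the problem is moved to a shorter word.\<close>

lemma exchange_and_conj:
  assumes "u \<in> lists S" "t \<in> S"
  shows "(ht (foldr act u (root t)) < 0 \<longrightarrow>
            (\<exists>v\<in>lists S. length v < length u \<and> u \<approx> v @ [t])) \<and>
         (\<forall>s\<in>S. foldr act u (root t) = root s \<longrightarrow> u @ [t] \<approx> s # u)"
  using assms
proof (induction "length u" arbitrary: u t rule: less_induct)
  case less
  have exch: "\<exists>v\<in>lists S. length v < length w \<and> w \<approx> v @ [t]"
    if "length w < length u" "w \<in> lists S" "t \<in> S" "ht (foldr act w (root t)) < 0" for w t
    using less.hyps that by blast
  have conj: "w @ [t] \<approx> s # w"
    if "length w < length u" "w \<in> lists S" "t \<in> S" "s \<in> S" "foldr act w (root t) = root s" for w t s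
    using less.hyps that by blast
  have A: "\<exists>v\<in>lists S. length v < length u \<and> u \<approx> v @ [t]" if neg: "ht (foldr act u (root t)) < 0"
  proof -
    obtain x s y where u: "u = x @ s # y" and y: "foldr act y (root t) = root s"
      using negated_split[OF less.prems(1) root_R[OF less.prems(2)] _ neg] ht_root[OF less.prems(2)]
      by auto
    have "x @ (y @ [t]) \<approx> x @ (s # y)"
      using less.prems u y by (intro equ_append_left conj) auto
    then have "u \<approx> (x @ y) @ [t]" using u by (simp add: cox_equiv.sym)
    then show ?thesis using u less.prems by (intro bexI[of _ "x @ y"]) auto
  qed
  have B: "u @ [t] \<approx> s # u" if s: "s \<in> S" and us: "foldr act u (root t) = root s" for s
  proof (cases u rule: rev_cases)
    case Nil
    then have "s = t" using us s less.prems inj_root by (auto dest: inj_onD)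
    then show ?thesis using Nil s by (auto intro: cox_equiv.refl)
  next
    case (snoc w r)
    have wr: "w \<in> lists S" "r \<in> S" "length w < length u" using snoc less.prems by auto
    \<comment> \<open>If \<open>w\<close> negates the root of \<open>r\<close>, it can be rewritten
      to end in \<open>r\<close>. Then \<open>u\<close> ends in \<open>r\<close> twice and shrinks
      to \<open>v\<close>, which is short enough for the induction hypothesis.\<close>
    have cancel: ?thesis if neg: "ht (foldr act w (root r)) < 0"
    proof -
      obtain v where v: "v \<in> lists S" "length v < length w" "w \<approx> v @ [r]"
        using exch[OF wr(3,1,2) neg] by blast
      have "u \<approx> (v @ [r]) @ [r]" unfolding snoc using v wr by - (rule equ_append_right; auto)
      also have "(v @ [r]) @ [r] = v @ [r, r]" by simp
      also have "v @ [r, r] \<approx> v @ []" using v wr by (intro equ_append_left equ_square) auto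
      finally have uv: "u \<approx> v" by simp
      then have "foldr act v (root t) = root s" using act_cong us root_R less.prems by metis
      then have "v @ [t] \<approx> s # v" using v wr s less.prems by - (rule conj; auto)
      then show ?thesis using uv s less.prems by - (rule equ_conj_via_shorter; auto)
    qed
    consider "r = t" | "r \<noteq> t" "m r t = 2" | "r \<noteq> t" "m r t = 3"
      using m_off_diag wr less.prems by blast
    then show ?thesis
    proof cases
      case 1
      have "neg (foldr act w (root t)) = root s"
        using us snoc 1 wr by (simp add: act_root foldr_act_neg root_R)
      then have "ht (foldr act w (root t)) = - 1"
        using ht_neg[of "foldr act w (root t)"] ht_root[OF s] foldr_act_R root_R wr 1 by auto
      then show ?thesis using cancel 1 by simp
    next
      case 2
      have "foldr act w (root t) = root s" using us snoc act_root_2 2 wr less.prems by auto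
      then have w: "w @ [t] \<approx> s # w" using wr s less.prems by - (rule conj; auto)
      have "w @ [r, t] \<approx> w @ [t, r]"
        using 2 wr less.prems by (intro equ_append_left equ_braid_2) auto
      also have "w @ [t, r] = (w @ [t]) @ [r]" by simp
      also have "(w @ [t]) @ [r] \<approx> (s # w) @ [r]" using w wr by - (rule equ_append_right; auto)
      finally show ?thesis using snoc by simp
    next
      case 3
      \<comment> \<open>The word \<open>u\<close> sends the root of \<open>t\<close> where
        \<open>w\<close> sends the sum of the roots of \<open>r\<close> and \<open>t\<close>, and
        that is a simple root, of height 1. Two nonzero integers with sum 1 are not both positive,
        so \<open>w\<close> negates one of the two roots.\<close>
      have "ht (foldr act w (root r)) + ht (foldr act w (root t)) = 1"
        using us snoc ht_act_root_3[of r t w] 3 wr less.prems ht_root[OF s] by simp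
      moreover have "ht (foldr act w (root r)) \<noteq> 0" "ht (foldr act w (root t)) \<noteq> 0"
        using ht_nonzero foldr_act_R root_R wr less.prems by auto
      ultimately consider "ht (foldr act w (root r)) < 0" | "ht (foldr act w (root t)) < 0"
        by linarith
      then show ?thesis
      proof cases
        case 1
        then show ?thesis by (rule cancel)
      next
        case 2
        then obtain v where v: "v \<in> lists S" "length v < length w" "w \<approx> v @ [t]"
          using exch wr less.prems by blast
        have "u \<approx> (v @ [t]) @ [r]" unfolding snoc using v wr by - (rule equ_append_right; auto)
        then have u: "u \<approx> v @ [t, r]" by simp
        \<comment> \<open>Applying \<open>r\<close> and then \<open>t\<close> takes the root of
          \<open>t\<close> to the root of \<open>r\<close>, so \<open>v\<close> carries the root of
          \<open>r\<close> to that of \<open>s\<close>. The braid relation then moves the final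
          letter next to \<open>v\<close>, where the induction hypothesis pulls it through.\<close>
        have "foldr act v (act t (act r (root t))) = root s"
          using act_cong[OF u root_R] us less.prems by simp
        then have "foldr act v (root r) = root s"
          using act_root_3 3 wr less.prems by simp
        then have vr: "v @ [r] \<approx> s # v" using v wr s by - (rule conj; auto)
        have "v @ [t, r, t] \<approx> v @ [r, t, r]"
          using 3 v wr less.prems by (intro equ_append_left equ_braid_3) auto
        also have "v @ [r, t, r] = (v @ [r]) @ [t, r]" by simp
        also have "(v @ [r]) @ [t, r] \<approx> (s # v) @ [t, r]"
          using vr wr less.prems by - (rule equ_append_right; auto)
        finally have "(v @ [t, r]) @ [t] \<approx> s # (v @ [t, r])" by simp
        then show ?thesis using equ_conj_via_shorter u s less.prems by blast
      qed
    qed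
  qed
  show ?case using A B by blast
qed

section \<open>Inversions and length\<close>

definition inversions :: "('r \<Rightarrow> 'r) \<Rightarrow> 'r set" where
  "inversions F = {\<beta> \<in> R. 0 < ht \<beta> \<and> ht (F \<beta>) < 0}"

lemma finite_inversions: "finite (inversions F)"
  using finite_R by (simp add: inversions_def)

lemma inversions_cong: "(\<And>\<beta>. \<beta> \<in> R \<Longrightarrow> F \<beta> = F' \<beta>) \<Longrightarrow> inversions F = inversions F'"
  by (auto simp: inversions_def)

text \<open>A simple reflection permutes the positive roots other than its own. Thus the inversions
  of \<open>F\<close> are carried over by \<open>act t\<close>, and the root of \<open>t\<close> is
  the one new inversion.\<close>

lemma card_inversions_up:
  assumes t: "t \<in> S" and "F (neg (root t)) = neg (F (root t))"
    and "F (root t) \<in> R" and pos: "0 < ht (F (root t))"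
  shows "card (inversions (F \<circ> act t)) = Suc (card (inversions F))"
proof -
  have act_pos: "0 < ht (act t \<beta>)" if "\<beta> \<in> R" "0 < ht \<beta>" "\<beta> \<noteq> root t" for \<beta>
    using root_if_negated[OF t that(1,2)] that ht_nonzero act_R t by force
  have "inversions (F \<circ> act t) = insert (root t) (act t ` inversions F)"
  proof (intro equalityI subsetI)
    fix \<beta> assume \<beta>: "\<beta> \<in> inversions (F \<circ> act t)"
    show "\<beta> \<in> insert (root t) (act t ` inversions F)"
    proof (cases "\<beta> = root t")
      case False
      then have "act t \<beta> \<in> inversions F"
        using \<beta> act_pos[of \<beta>] act_R t by (auto simp: inversions_def)
      moreover have "\<beta> = act t (act t \<beta>)" using act_act t \<beta> by (simp add: inversions_def)
      ultimately show ?thesis by blast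
    qed simp
  next
    fix \<beta> assume "\<beta> \<in> insert (root t) (act t ` inversions F)"
    then consider "\<beta> = root t" | \<gamma> where "\<beta> = act t \<gamma>" "\<gamma> \<in> inversions F" by blast
    then show "\<beta> \<in> inversions (F \<circ> act t)"
    proof cases
      case 1
      then show ?thesis using assms root_R ht_root by (simp add: inversions_def act_root ht_neg)
    next
      case 2
      then have "\<gamma> \<noteq> root t" using pos by (auto simp: inversions_def)
      then show ?thesis
        using 2 act_pos[of \<gamma>] act_R act_act t by (simp add: inversions_def)
    qed
  qed
  moreover have "root t \<notin> act t ` inversions F"
  proof
    assume "root t \<in> act t ` inversions F"
    then obtain \<gamma> where g: "\<gamma> \<in> R" "0 < ht \<gamma>" "root t = act t \<gamma>" by (auto simp: inversions_def)
    then have "\<gamma> = neg (root t)" using act_act[OF t g(1)] act_root[OF t] by simp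
    then show False using g ht_neg[OF root_R[OF t]] ht_root[OF t] by simp
  qed
  moreover have "inj_on (act t) (inversions F)"
    by (rule inj_on_inverseI[of _ "act t"]) (auto simp: inversions_def act_act t)
  ultimately show ?thesis using finite_inversions by (simp add: card_image)
qed

text \<open>This is \<open>card_inversions_up\<close> for \<open>F \<circ> act t\<close>. Both are
  stated for maps and not for words, since \<open>D_perm_word\<close> applies the count to signed
  permutations that are not yet known to come from words.\<close>

lemma card_inversions_down:
  assumes t: "t \<in> S" and "F (neg (root t)) = neg (F (root t))"
    and "F (root t) \<in> R" and "ht (F (root t)) < 0"
  shows "card (inversions F) = Suc (card (inversions (F \<circ> act t)))"
proof -
  have nn: "act t (neg (root t)) = root t"
    using act_act[OF t root_R[OF t]] act_root[OF t] by simp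
  have "card (inversions ((F \<circ> act t) \<circ> act t)) = Suc (card (inversions (F \<circ> act t)))"
  proof (rule card_inversions_up[OF t])
    show "(F \<circ> act t) (neg (root t)) = neg ((F \<circ> act t) (root t))"
      using assms nn by (simp add: act_root neg_neg)
    show "(F \<circ> act t) (root t) \<in> R" using assms neg_R by (simp add: act_root)
    show "0 < ht ((F \<circ> act t) (root t))" using assms by (simp add: act_root ht_neg)
  qed
  moreover have "inversions ((F \<circ> act t) \<circ> act t) = inversions F"
    by (rule inversions_cong) (simp add: act_act t)
  ultimately show ?thesis by simp
qed


lemma exchange:
  assumes "u \<in> lists S" "t \<in> S" "ht (foldr act u (root t)) < 0"
  obtains v where "v \<in> lists S" "length v < length u" "u \<approx> v @ [t]"
  using exchange_and_conj assms by blast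

lemma card_inversions_snoc:
  assumes "u \<in> lists S" "t \<in> S"
  shows "0 < ht (foldr act u (root t)) \<Longrightarrow>
      card (inversions (foldr act (u @ [t]))) = Suc (card (inversions (foldr act u)))"
    and "ht (foldr act u (root t)) < 0 \<Longrightarrow>
      card (inversions (foldr act u)) = Suc (card (inversions (foldr act (u @ [t]))))"
proof -
  have "foldr act (u @ [t]) = foldr act u \<circ> act t" by auto
  then show "0 < ht (foldr act u (root t)) \<Longrightarrow>
      card (inversions (foldr act (u @ [t]))) = Suc (card (inversions (foldr act u)))"
    and "ht (foldr act u (root t)) < 0 \<Longrightarrow>
      card (inversions (foldr act u)) = Suc (card (inversions (foldr act (u @ [t]))))"
    using card_inversions_up[of t "foldr act u"] card_inversions_down[of t "foldr act u"]
      assms foldr_act_neg foldr_act_R root_R by simp_all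
qed

lemma inversions_Nil: "inversions (foldr act []) = {}"
  by (auto simp: inversions_def)

lemma card_inversions_le_length: "u \<in> lists S \<Longrightarrow> card (inversions (foldr act u)) \<le> length u"
proof (induction u rule: rev_induct)
  case Nil
  then show ?case by (simp add: inversions_Nil del: foldr.simps)
next
  case (snoc t u)
  then have "ht (foldr act u (root t)) \<noteq> 0" using ht_nonzero foldr_act_R root_R by simp
  then show ?case using card_inversions_snoc[of u t] snoc
    by (cases "ht (foldr act u (root t)) < 0") (simp_all del: foldr_append)
qed

text \<open>The reduced word grows letter by letter: a letter whose root stays positive is appended,
  and otherwise the exchange property absorbs it.\<close>

lemma reduced_word:
  assumes "u \<in> lists S"
  obtains v where "v \<in> lists S" "v \<approx> u" "length v = card (inversions (foldr act u))"
  using assms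
proof (induction u arbitrary: thesis rule: rev_induct)
  case Nil
  then show ?case using Nil.prems(1)[of "[]"] by (simp add: inversions_Nil cox_equiv.refl del: foldr.simps)
next
  case (snoc t u)
  have u: "u \<in> lists S" "t \<in> S" using snoc.prems by auto
  obtain v where v: "v \<in> lists S" "v \<approx> u" "length v = card (inversions (foldr act u))"
    using snoc.IH u by blast
  have vt: "v @ [t] \<approx> u @ [t]" by (rule equ_append_right) (use v u in auto)
  have same: "foldr act v (root t) = foldr act u (root t)"
    using act_cong v root_R u by blast
  show ?case
  proof (cases "ht (foldr act u (root t)) < 0")
    case True
    then obtain x where x: "x \<in> lists S" "length x < length v" "v \<approx> x @ [t]"
      using exchange[of v t] same v u by auto
    have "x \<approx> x @ [t, t]"
      using equ_append_left[OF x(1) equ_square[OF u(2)]] by (simp add: cox_equiv.sym)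
    also have "x @ [t, t] = (x @ [t]) @ [t]" by simp
    also have "(x @ [t]) @ [t] \<approx> v @ [t]"
      by (rule equ_append_right) (use x u in \<open>auto intro: cox_equiv.sym\<close>)
    also note vt
    finally have xu: "x \<approx> u @ [t]" .
    have "inversions (foldr act x) = inversions (foldr act (u @ [t]))"
      using act_cong[OF xu] by (rule inversions_cong)
    \<comment> \<open>Exchange only yields that \<open>x\<close> is shorter than \<open>v\<close>;
      the lower bound by the number of inversions forces the exact length.\<close>
    then have "length x = card (inversions (foldr act (u @ [t])))"
      using card_inversions_snoc(2)[OF u True] card_inversions_le_length[OF x(1)] x v by simp
    then show ?thesis using snoc.prems(1) x xu by blast
  next
    case False
    then have "0 < ht (foldr act u (root t))"
      using ht_nonzero[of "foldr act u (root t)"] foldr_act_R root_R u by force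
    then have "length (v @ [t]) = card (inversions (foldr act (u @ [t])))"
      using card_inversions_snoc(1)[OF u] v by simp
    then show ?thesis using snoc.prems(1)[of "v @ [t]"] vt v u by (simp del: foldr_append)
  qed
qed

lemma cox_length_eq:
  assumes "u \<in> lists S"
  shows "cox_length (cox_class S m u) = card (inversions (foldr act u))"
  unfolding cox_length_def
proof (rule Least_equality)
  obtain v where "v \<in> lists S" "v \<approx> u" "length v = card (inversions (foldr act u))"
    using reduced_word[OF assms] .
  then show "\<exists>v\<in>cox_class S m u. length v = card (inversions (foldr act u))"
    by (auto simp: cox_class_def cox_rel_def intro: cox_equiv.sym)
next
  fix k assume "\<exists>v\<in>cox_class S m u. length v = k"
  then obtain v where v: "u \<approx> v" "length v = k" by (auto simp: cox_class_def cox_rel_def)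
  have "inversions (foldr act u) = inversions (foldr act v)"
    using act_cong[OF v(1)] by (rule inversions_cong)
  moreover have "v \<in> lists S" using cox_equiv_lists v by blast
  ultimately show "card (inversions (foldr act u)) \<le> k"
    using card_inversions_le_length v by auto
qed

text \<open>A root inverted by \<open>u @ rev v\<close> would, up to sign, give a root inverted by
  exactly one of \<open>u\<close> and \<open>v\<close>. So \<open>u @ rev v\<close> has no
  inversion, and its reduced word is empty. Faithfulness of the action follows, because the action
  determines the inversions.\<close>

lemma equ_if_inversions_eq:
  assumes u: "u \<in> lists S" and v: "v \<in> lists S"
    and eq: "inversions (foldr act u) = inversions (foldr act v)"
  shows "u \<approx> v"
proof -
  have rv: "rev v \<in> lists S" using v by (simp add: in_lists_conv_set)
  let ?w = "u @ rev v"
  have "inversions (foldr act ?w) = {}"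
  proof (rule ccontr)
    assume "inversions (foldr act ?w) \<noteq> {}"
    then obtain \<beta> where \<beta>: "\<beta> \<in> R" "0 < ht \<beta>" "ht (foldr act ?w \<beta>) < 0"
      by (auto simp: inversions_def)
    define \<gamma> where "\<gamma> = foldr act (rev v) \<beta>"
    have \<gamma>: "\<gamma> \<in> R" "foldr act v \<gamma> = \<beta>" "ht (foldr act u \<gamma>) < 0"
      using \<beta> foldr_act_R[OF rv] foldr_act_rev[OF v] by (simp_all add: \<gamma>_def)
    show False
    proof (cases "0 < ht \<gamma>")
      case True
      then have "\<gamma> \<in> inversions (foldr act u)" using \<gamma> by (simp add: inversions_def)
      then have "\<gamma> \<in> inversions (foldr act v)" using eq by simp
      then show False using \<beta> \<gamma> by (simp add: inversions_def)
    next
      case False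
      \<comment> \<open>Now \<open>neg \<gamma>\<close> is the positive root; \<open>v\<close> sends
        it to the negative of \<open>\<beta>\<close> and so inverts it, while \<open>u\<close> sends
        it to a positive root.\<close>
      then have "0 < ht (neg \<gamma>)" using ht_neg ht_nonzero[of \<gamma>] \<gamma> by simp
      then have "neg \<gamma> \<in> inversions (foldr act v)"
        using \<gamma> \<beta> v by (simp add: inversions_def neg_R foldr_act_neg ht_neg)
      then have "ht (foldr act u (neg \<gamma>)) < 0" unfolding eq[symmetric] by (simp add: inversions_def)
      then show False using \<gamma> u by (simp add: foldr_act_neg ht_neg foldr_act_R)
    qed
  qed
  then have "u @ rev v \<approx> []"
    using reduced_word[of ?w] u rv by (metis append_in_lists_conv card.empty cox_equiv.sym length_0_conv)
  also have "[] \<approx> v @ rev v"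
  proof -
    have "v @ rev v \<approx> []" using v
    proof (induction v)
      case Nil
      then show ?case by (simp add: cox_equiv.refl)
    next
      case (Cons s v)
      have "[s] @ (v @ rev v) @ [s] \<approx> [s] @ [] @ [s]"
        using Cons by (intro equ_append_left equ_append_right) auto
      also have "[s] @ [] @ [s] \<approx> []" using equ_square Cons by simp
      finally show ?case by simp
    qed
    then show ?thesis by (rule cox_equiv.sym)
  qed
  finally show ?thesis using equ_cancel_right u v rv by blast
qed

text \<open>In the intended use \<open>P\<close> is the root subsystem spanned by the simple roots of \<open>I\<close>; it
  contains the inversions of every element of the parabolic subgroup.\<close>

lemma longest_element_eq:
  assumes I: "I \<subseteq> S" and u: "u \<in> lists I" and P: "P \<subseteq> R"
    and root_P: "\<And>s. s \<in> I \<Longrightarrow> root s \<in> P"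
    and act_P: "\<And>s \<beta>. s \<in> I \<Longrightarrow> \<beta> \<in> P \<Longrightarrow> act s \<beta> \<in> P"
    and negate: "\<And>\<beta>. \<beta> \<in> P \<Longrightarrow> 0 < ht \<beta> \<Longrightarrow> ht (foldr act u \<beta>) < 0"
  shows "longest_element S m I = cox_class S m u"
proof -
  have sub: "v \<in> lists S" if "v \<in> lists I" for v using that I by auto
  \<comment> \<open>Letters act as involutions, so \<open>P\<close> is closed under preimages as
    well as images.\<close>
  have in_P: "\<beta> \<in> P" if "v \<in> lists I" "\<beta> \<in> R" "foldr act v \<beta> \<in> P" for v \<beta>
    using that
  proof (induction v)
    case (Cons s v)
    have "foldr act v \<beta> = act s (foldr act (s # v) \<beta>)"
      using Cons I foldr_act_R[OF sub, of v \<beta>] act_act[of s "foldr act v \<beta>"] by auto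
    moreover have "act s (foldr act (s # v) \<beta>) \<in> P" using Cons act_P by auto
    ultimately have "foldr act v \<beta> \<in> P" by (rule ssubst)
    then show ?case using Cons by blast
  qed simp
  \<comment> \<open>Some right part of \<open>v\<close> takes an inversion to the simple root of a
    letter of \<open>I\<close>, hence into \<open>P\<close>; pull this back.\<close>
  have inv_P: "inversions (foldr act v) \<subseteq> P" if v: "v \<in> lists I" for v
  proof
    fix \<beta> assume "\<beta> \<in> inversions (foldr act v)"
    then have \<beta>: "\<beta> \<in> R" "0 < ht \<beta>" "ht (foldr act v \<beta>) < 0" by (simp_all add: inversions_def)
    obtain x s y where "v = x @ s # y" "foldr act y \<beta> = root s"
      using negated_split[OF sub[OF v] \<beta>] .
    then show "\<beta> \<in> P" using in_P[of y \<beta>] root_P v \<beta> by simp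
  qed
  have inv_sub: "inversions (foldr act v) \<subseteq> inversions (foldr act u)" if "v \<in> lists I" for v
    using inv_P[OF that] negate by (auto simp: inversions_def)
  have par: "parabolic S m I = cox_class S m ` lists I"
    using cox_class_parabolic[OF I] m_diag by blast
  show ?thesis
    unfolding longest_element_def
  proof (rule the_equality)
    show "cox_class S m u \<in> parabolic S m I \<and>
        (\<forall>v\<in>parabolic S m I. cox_length v \<le> cox_length (cox_class S m u))"
      using u sub by (auto simp: par cox_length_eq intro!: card_mono inv_sub finite_inversions)
  next
    fix w assume w: "w \<in> parabolic S m I \<and> (\<forall>v\<in>parabolic S m I. cox_length v \<le> cox_length w)"
    then obtain v where v: "v \<in> lists I" "w = cox_class S m v" by (auto simp: par)
    have "card (inversions (foldr act u)) \<le> card (inversions (foldr act v))"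
      using w v u sub cox_length_eq by (auto simp: par)
    \<comment> \<open>All inversion sets from the parabolic subgroup lie in that of
      \<open>u\<close>; one of at least the same size must be equal to it, and equal inversions mean
      equal elements.\<close>
    then have "inversions (foldr act v) = inversions (foldr act u)"
      using card_seteq[OF finite_inversions inv_sub[OF v(1)]] by blast
    then show "w = cox_class S m u"
      using equ_if_inversions_eq u v sub by (simp add: cox_class_eq_iff)
  qed
qed

end

section \<open>The signed permutations of type D\<close>

text \<open>The integer \<open>a\<close> with \<open>1 \<le> \<bar>a\<bar> \<le> r\<close> stands for the vector \<open>e\<^sub>a\<close>, with
  \<open>e\<^sub>-\<^sub>a = - e\<^sub>a\<close>, and the set \<open>{a, b}\<close> stands for the root \<open>e\<^sub>a + e\<^sub>b\<close>; \<open>reflect p q\<close> is the reflection in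
  \<open>e\<^sub>p + e\<^sub>q\<close>. The height of a root is its inner product with
  \<open>\<rho> = (r - 1) e\<^sub>1 + \<dots> + 1 e\<^sub>r\<^sub>-\<^sub>1 + 0 e\<^sub>r\<close>.\<close>

definition reflect :: "int \<Rightarrow> int \<Rightarrow> int \<Rightarrow> int" where
  "reflect p q a = (if a = p then - q else if a = q then - p
                 else if a = - p then q else if a = - q then p else a)"

text \<open>The simple root of node t < r is e_t - e_(t+1) and that of node r is e_(r-1) + e_r;
  \<open>D_fst\<close> and \<open>D_snd\<close> are its two signed coordinates.\<close>

definition D_fst :: "nat \<Rightarrow> nat \<Rightarrow> int" where
  "D_fst r t = (if t = r then int r - 1 else int t)"

definition D_snd :: "nat \<Rightarrow> nat \<Rightarrow> int" where
  "D_snd r t = (if t = r then int r else - int t - 1)"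

definition D_act :: "nat \<Rightarrow> nat \<Rightarrow> int \<Rightarrow> int" where
  "D_act r t = reflect (D_fst r t) (D_snd r t)"

definition D_root :: "nat \<Rightarrow> nat \<Rightarrow> int set" where
  "D_root r t = {D_fst r t, D_snd r t}"

definition D_roots :: "nat \<Rightarrow> int set set" where
  "D_roots r = {{a, b} | a b. 1 \<le> \<bar>a\<bar> \<and> \<bar>a\<bar> \<le> int r \<and> 1 \<le> \<bar>b\<bar> \<and> \<bar>b\<bar> \<le> int r \<and> \<bar>a\<bar> \<noteq> \<bar>b\<bar>}"

definition coord_ht :: "nat \<Rightarrow> int \<Rightarrow> int" where
  "coord_ht r a = sgn a * (int r - \<bar>a\<bar>)"

definition D_ht :: "nat \<Rightarrow> int set \<Rightarrow> int" where
  "D_ht r \<beta> = (\<Sum>a\<in>\<beta>. coord_ht r a)"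

section \<open>Reflections and simple roots of type D\<close>

lemma reflect_minus: "p \<noteq> 0 \<Longrightarrow> q \<noteq> 0 \<Longrightarrow> \<bar>p\<bar> \<noteq> \<bar>q\<bar> \<Longrightarrow> reflect p q (- a) = - reflect p q a"
  by (auto simp: reflect_def)

lemma reflect_reflect: "p \<noteq> 0 \<Longrightarrow> q \<noteq> 0 \<Longrightarrow> \<bar>p\<bar> \<noteq> \<bar>q\<bar> \<Longrightarrow> reflect p q (reflect p q a) = a"
  by (auto simp: reflect_def)

lemma abs_reflect:
  "\<bar>reflect p q a\<bar> = (if \<bar>a\<bar> = \<bar>p\<bar> then \<bar>q\<bar> else if \<bar>a\<bar> = \<bar>q\<bar> then \<bar>p\<bar> else \<bar>a\<bar>)"
  by (auto simp: reflect_def)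

lemma abs_reflect_eq_iff:
  "\<bar>reflect p q a\<bar> = \<bar>reflect p q b\<bar> \<longleftrightarrow> \<bar>a\<bar> = \<bar>b\<bar>"
  unfolding abs_reflect by auto

lemma reflect_other: "\<bar>a\<bar> \<noteq> \<bar>p\<bar> \<Longrightarrow> \<bar>a\<bar> \<noteq> \<bar>q\<bar> \<Longrightarrow> reflect p q a = a"
  by (auto simp: reflect_def)

lemma reflect_fst: "reflect p q p = - q"
  by (simp add: reflect_def)

lemma reflect_snd: "reflect p q q = - p"
  by (simp add: reflect_def)

lemma reflect_commutes: "reflect p q = reflect q p"
  by (rule ext) (auto simp: reflect_def)

lemma reflect_conj:
  assumes "inj f" and "\<And>a. f (- a) = - f a"
  shows "f (reflect p q a) = reflect (f p) (f q) (f a)"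
proof -
  have "f a = f b \<longleftrightarrow> a = b" "f a = - f b \<longleftrightarrow> a = - b" for b
    using assms(1) assms(2)[of b, symmetric] by (auto simp: inj_eq)
  then show ?thesis by (simp add: reflect_def assms(2))
qed

text \<open>Both the commutation and the braid relations in \<open>D_act_relator\<close> are read
  off from this conjugation rule.\<close>

lemma reflect_conj_reflect:
  assumes "p \<noteq> 0" "q \<noteq> 0" "\<bar>p\<bar> \<noteq> \<bar>q\<bar>"
  shows "reflect p q (reflect p' q' a) = reflect (reflect p q p') (reflect p q q') (reflect p q a)"
proof (rule reflect_conj)
  show "inj (reflect p q)" using assms by (metis injI reflect_reflect)
qed (use assms in \<open>rule reflect_minus\<close>)

lemma D_fst_snd:
  assumes "4 \<le> r" "t \<in> D_nodes r"
  shows "1 \<le> D_fst r t" "D_fst r t \<le> int r" "1 \<le> \<bar>D_snd r t\<bar>" "\<bar>D_snd r t\<bar> \<le> int r"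
    "\<bar>D_fst r t\<bar> \<noteq> \<bar>D_snd r t\<bar>" "D_fst r t \<noteq> D_snd r t" "D_fst r t \<noteq> 0" "D_snd r t \<noteq> 0"
  using assms by (cases "t = r"; simp add: D_fst_def D_snd_def D_nodes_def)+

lemma D_act_minus: "4 \<le> r \<Longrightarrow> t \<in> D_nodes r \<Longrightarrow> D_act r t (- a) = - D_act r t a"
  unfolding D_act_def by (rule reflect_minus) (use D_fst_snd in auto)

lemma D_act_D_act: "4 \<le> r \<Longrightarrow> t \<in> D_nodes r \<Longrightarrow> D_act r t (D_act r t a) = a"
  unfolding D_act_def by (rule reflect_reflect) (use D_fst_snd in auto)

lemma abs_D_act_eq_iff: "\<bar>D_act r t a\<bar> = \<bar>D_act r t b\<bar> \<longleftrightarrow> \<bar>a\<bar> = \<bar>b\<bar>"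
  unfolding D_act_def by (rule abs_reflect_eq_iff)

lemma abs_D_act_range:
  assumes "4 \<le> r" "t \<in> D_nodes r" "1 \<le> \<bar>a\<bar>" "\<bar>a\<bar> \<le> int r"
  shows "1 \<le> \<bar>D_act r t a\<bar>" "\<bar>D_act r t a\<bar> \<le> int r"
  using D_fst_snd[OF assms(1,2)] assms(3,4) by (simp_all add: D_act_def abs_reflect)

lemma coord_ht_minus: "coord_ht r (- a) = - coord_ht r a"
  by (simp add: coord_ht_def)

lemma coord_ht_simple:
  assumes "4 \<le> r" "t \<in> D_nodes r"
  shows "coord_ht r (D_fst r t) + coord_ht r (D_snd r t) = 1"
  using assms by (auto simp: coord_ht_def D_fst_def D_snd_def D_nodes_def)

text \<open>The two coordinates of a simple root have heights with sum 1, so a simple reflection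
  changes the height of a coordinate by at most 1. This bound is what yields
  \<open>root_if_negated\<close> for type D.\<close>

lemma coord_ht_D_act:
  assumes "4 \<le> r" "t \<in> D_nodes r"
  shows "coord_ht r (D_act r t a) = coord_ht r a
    - (if a = D_fst r t \<or> a = D_snd r t then 1 else 0)
    + (if a = - D_fst r t \<or> a = - D_snd r t then 1 else 0)"
proof -
  define p q where "p = D_fst r t" and "q = D_snd r t"
  have "coord_ht r q = 1 - coord_ht r p" "p \<noteq> 0" "q \<noteq> 0" "p \<noteq> q" "p \<noteq> - q"
    using coord_ht_simple[OF assms] D_fst_snd[OF assms] by (auto simp: p_def q_def)
  then have "coord_ht r (reflect p q a) = coord_ht r a
    - (if a = p \<or> a = q then 1 else 0) + (if a = - p \<or> a = - q then 1 else 0)"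
    by (simp add: reflect_def coord_ht_minus)
  then show ?thesis by (simp add: D_act_def p_def q_def)
qed

lemma D_ht_pair: "a \<noteq> b \<Longrightarrow> D_ht r {a, b} = coord_ht r a + coord_ht r b"
  by (simp add: D_ht_def)

text \<open>Adjacent simple roots share one coordinate, with opposite signs. Bringing every kind of
  edge into the form e_x + e_y and -e_y + e_z lets the braid relation and the action on roots be
  checked once.\<close>

lemma D_matrix_3:
  assumes r: "4 \<le> r" and st: "s \<in> D_nodes r" "t \<in> D_nodes r" and "D_matrix r s t = 3"
  obtains x y z where "D_act r s = reflect x y" "D_root r s = {x, y}"
    "D_act r t = reflect (- y) z" "D_root r t = {- y, z}"
    "x \<noteq> 0" "y \<noteq> 0" "z \<noteq> 0" "\<bar>x\<bar> \<noteq> \<bar>y\<bar>" "\<bar>y\<bar> \<noteq> \<bar>z\<bar>" "\<bar>x\<bar> \<noteq> \<bar>z\<bar>"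
proof -
  have "{s, t} \<in> D_edges r" using assms by (auto simp: D_matrix_def split: if_splits)
  then have "t = s + 1 \<and> t \<le> r - 1 \<or> s = t + 1 \<and> s \<le> r - 1 \<or> s = r - 2 \<and> t = r \<or> s = r \<and> t = r - 2"
    using r by (auto simp: D_edges_def doubleton_eq_iff)
  then consider "t = s + 1" "t \<le> r - 1" | "s = t + 1" "s \<le> r - 1" | "s = r - 2" "t = r"
    | "s = r" "t = r - 2" by blast
  then have "\<exists>x y z. (D_fst r s, D_snd r s) \<in> {(x, y), (y, x)} \<and>
      (D_fst r t, D_snd r t) \<in> {(- y, z), (z, - y)} \<and> \<bar>x\<bar> \<noteq> \<bar>z\<bar>"
  proof cases
    case 1
    then show ?thesis using r st
      by (intro exI[of _ "int s"] exI[of _ "- int s - 1"] exI[of _ "- int s - 2"])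
        (auto simp: D_fst_def D_snd_def D_nodes_def)
  next
    case 2
    then show ?thesis using r st
      by (intro exI[of _ "- int t - 2"] exI[of _ "int t + 1"] exI[of _ "int t"])
        (auto simp: D_fst_def D_snd_def D_nodes_def)
  next
    case 3
    then show ?thesis using r st
      by (intro exI[of _ "int r - 2"] exI[of _ "1 - int r"] exI[of _ "int r"])
        (auto simp: D_fst_def D_snd_def D_nodes_def)
  next
    case 4
    then show ?thesis using r st
      by (intro exI[of _ "int r"] exI[of _ "int r - 1"] exI[of _ "int r - 2"])
        (auto simp: D_fst_def D_snd_def D_nodes_def)
  qed
  then obtain x y z where xy: "(D_fst r s, D_snd r s) \<in> {(x, y), (y, x)}"
    and yz: "(D_fst r t, D_snd r t) \<in> {(- y, z), (z, - y)}" and xz: "\<bar>x\<bar> \<noteq> \<bar>z\<bar>" by blast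
  show thesis
  proof (rule that)
    show "D_act r s = reflect x y" "D_root r s = {x, y}"
      using xy reflect_commutes[of x y] by (auto simp: D_act_def D_root_def)
    show "D_act r t = reflect (- y) z" "D_root r t = {- y, z}"
      using yz reflect_commutes[of "- y" z] by (auto simp: D_act_def D_root_def)
    have "x \<noteq> 0 \<and> y \<noteq> 0 \<and> \<bar>x\<bar> \<noteq> \<bar>y\<bar>" "z \<noteq> 0 \<and> \<bar>y\<bar> \<noteq> \<bar>z\<bar>"
      using xy yz D_fst_snd(5,7,8)[OF r st(1)] D_fst_snd(5,7,8)[OF r st(2)]
      by (metis Pair_inject abs_minus_cancel insertE neg_equal_0_iff_equal singletonD)+
    then show "x \<noteq> 0" "y \<noteq> 0" "z \<noteq> 0" "\<bar>x\<bar> \<noteq> \<bar>y\<bar>" "\<bar>y\<bar> \<noteq> \<bar>z\<bar>" "\<bar>x\<bar> \<noteq> \<bar>z\<bar>"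
      using xz by blast+
  qed
qed

text \<open>The second alternative is the pair of nodes r-1 and r: their roots e_(r-1) - e_r and
  e_(r-1) + e_r are orthogonal although they have the same support.\<close>

lemma D_matrix_2:
  assumes r: "4 \<le> r" and st: "s \<in> D_nodes r" "t \<in> D_nodes r" and "D_matrix r s t = 2"
  shows "{\<bar>D_fst r s\<bar>, \<bar>D_snd r s\<bar>} \<inter> {\<bar>D_fst r t\<bar>, \<bar>D_snd r t\<bar>} = {} \<or>
    D_fst r s = D_fst r t \<and> D_snd r s = - D_snd r t"
proof -
  have e: "{s, t} \<notin> D_edges r" "s \<noteq> t" using assms by (auto simp: D_matrix_def split: if_splits)
  have edge: "{a, a + 1} \<in> D_edges r" if "1 \<le> a" "a + 1 \<le> r - 1" for a
    using that r by (cases "a + 1 = r - 1") (auto simp: D_edges_def doubleton_eq_iff)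
  have "{s, t} \<in> D_edges r" if "t = s + 1" "t \<le> r - 1"
    using edge[of s] that st by (simp add: D_nodes_def)
  moreover have "{s, t} \<in> D_edges r" if "s = t + 1" "s \<le> r - 1"
    using edge[of t] that st by (simp add: D_nodes_def insert_commute)
  moreover have "{s, t} \<in> D_edges r" if "s = r - 2" "t = r \<or> t = r - 1"
    using that by (auto simp: D_edges_def doubleton_eq_iff)
  moreover have "{s, t} \<in> D_edges r" if "t = r - 2" "s = r \<or> s = r - 1"
    using that by (auto simp: D_edges_def doubleton_eq_iff)
  ultimately have n: "t = s + 1 \<Longrightarrow> t = r" "s = t + 1 \<Longrightarrow> s = r" "t = r \<Longrightarrow> s + 2 \<noteq> r" "s = r \<Longrightarrow> t + 2 \<noteq> r"
    using e st by (fastforce simp: D_nodes_def)+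
  consider "s = r" "t < r" | "t = r" "s < r" | "s < r" "t < r"
    using st e by (fastforce simp: D_nodes_def)
  then show ?thesis
  proof cases
    case 1
    then show ?thesis
      using n(4) st by (cases "t + 1 = r") (auto simp: D_fst_def D_snd_def D_nodes_def)
  next
    case 2
    then show ?thesis
      using n(3) st by (cases "s + 1 = r") (auto simp: D_fst_def D_snd_def D_nodes_def)
  next
    case 3
    then show ?thesis
      using n(1,2) e(2) st by (auto simp: D_fst_def D_snd_def D_nodes_def)
  qed
qed

lemma D_act_relator:
  assumes r: "4 \<le> r" and st: "s \<in> D_nodes r" "t \<in> D_nodes r"
  shows "foldr (D_act r) (concat (replicate (D_matrix r s t) [s, t])) a = a"
proof -
  have conj: "D_act r s (D_act r t b) = reflect (D_act r s (D_fst r t)) (D_act r s (D_snd r t)) (D_act r s b)"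
    if "s \<in> D_nodes r" for s t b
    using D_fst_snd[OF r that] unfolding D_act_def by (intro reflect_conj_reflect) auto
  have "D_matrix r s t = 1 \<and> s = t \<or> D_matrix r s t = 2 \<or> D_matrix r s t = 3"
    by (auto simp: D_matrix_def)
  then consider "D_matrix r s t = 1" "s = t" | "D_matrix r s t = 2" | "D_matrix r s t = 3" by blast
  then show ?thesis
  proof cases
    case 1
    then show ?thesis using D_act_D_act[OF r st(1)] by simp
  next
    case 2
    have "D_act r s (D_act r t b) = D_act r t (D_act r s b)" for b
      using D_matrix_2[OF r st 2]
    proof
      assume "{\<bar>D_fst r s\<bar>, \<bar>D_snd r s\<bar>} \<inter> {\<bar>D_fst r t\<bar>, \<bar>D_snd r t\<bar>} = {}"
      then have "D_act r s (D_fst r t) = D_fst r t" "D_act r s (D_snd r t) = D_snd r t"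
        by (simp_all add: D_act_def reflect_other)
      then show ?thesis using conj[OF st(1), of t b] by (simp add: D_act_def)
    next
      assume *: "D_fst r s = D_fst r t \<and> D_snd r s = - D_snd r t"
      then have "D_act r s (D_fst r t) = D_snd r t" "D_act r s (D_snd r t) = D_fst r t"
        using reflect_fst[of "D_fst r s" "D_snd r s"] reflect_snd[of "D_fst r s" "D_snd r s"]
          D_act_minus[OF r st(1), of "D_snd r s"]
        by (simp_all add: D_act_def)
      then show ?thesis
        using conj[OF st(1), of t b] reflect_commutes[of "D_snd r t"] by (simp add: D_act_def)
    qed
    then have "D_act r s (D_act r t (D_act r s (D_act r t a))) = a"
      using D_act_D_act[OF r] st by simp
    then show ?thesis using 2 by (simp add: numeral_2_eq_2)
  next
    case 3
    then obtain x y z where h: "D_act r s = reflect x y" "D_act r t = reflect (- y) z"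
      "x \<noteq> 0" "y \<noteq> 0" "z \<noteq> 0" "\<bar>x\<bar> \<noteq> \<bar>y\<bar>" "\<bar>y\<bar> \<noteq> \<bar>z\<bar>" "\<bar>x\<bar> \<noteq> \<bar>z\<bar>"
      using D_matrix_3[OF r st] by metis
    have "reflect x y (- y) = x" "reflect x y z = z" "reflect (- y) z y = z" "reflect (- y) z x = x"
      using h(3-) reflect_minus[of x y y] reflect_minus[of "- y" z "- y"]
      by (simp_all add: reflect_fst reflect_snd reflect_other)
    \<comment> \<open>These say that s t s and t s t both act as \<open>reflect x z\<close>; the
      relator therefore acts as the square of a reflection.\<close>
    then have c: "D_act r s (D_act r t b) = reflect x z (D_act r s b)"
      and d: "D_act r t (D_act r s b) = reflect x z (D_act r t b)" for b
      using reflect_conj_reflect[of x y "- y" z b] reflect_conj_reflect[of "- y" z x y b] h(3-)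
      by (simp_all add: h(1,2))
    have "reflect x z (reflect x z b) = b" for b using h(3-) by (intro reflect_reflect)
    then have "D_act r s (D_act r t (D_act r s (D_act r t (D_act r s (D_act r t a))))) = a"
      using c[of "D_act r s (D_act r t (D_act r s (D_act r t a)))"] d[of "D_act r t a"]
        D_act_D_act[OF r] st by simp
    then show ?thesis using 3 by (simp add: numeral_3_eq_3)
  qed
qed

lemma D_root_D_roots: "4 \<le> r \<Longrightarrow> t \<in> D_nodes r \<Longrightarrow> D_root r t \<in> D_roots r"
  unfolding D_roots_def D_root_def using D_fst_snd[of r t]
  by (intro CollectI exI[of _ "D_fst r t"] exI[of _ "D_snd r t"]) auto

lemma foldr_D_act_minus:
  "4 \<le> r \<Longrightarrow> u \<in> lists (D_nodes r) \<Longrightarrow> foldr (D_act r) u (- a) = - foldr (D_act r) u a"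
  by (induction u) (auto simp: D_act_minus)

lemma abs_foldr_D_act_eq_iff:
  "\<bar>foldr (D_act r) u a\<bar> = \<bar>foldr (D_act r) u b\<bar> \<longleftrightarrow> \<bar>a\<bar> = \<bar>b\<bar>"
  by (induction u) (auto simp: abs_D_act_eq_iff)

lemma foldr_image: "foldr (\<lambda>t. (`) (f t)) u X = foldr f u ` X"
  by (induction u) auto

lemma D_simply_laced_action:
  assumes r: "4 \<le> r"
  shows "simply_laced_action (D_nodes r) (D_matrix r) (D_roots r)
    ((`) uminus) (\<lambda>t. (`) (D_act r t)) (D_root r) (D_ht r)"
proof
  show "finite (D_roots r)"
  proof (rule finite_subset)
    show "D_roots r \<subseteq> Pow {- int r..int r}" by (auto simp: D_roots_def)
  qed simp
  show "D_matrix r s s = 1" for s by (simp add: D_matrix_def)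
  show "D_matrix r s t = 2 \<or> D_matrix r s t = 3" if "s \<noteq> t" for s t
    using that by (simp add: D_matrix_def)
  show "inj_on (D_root r) (D_nodes r)"
  proof (rule inj_onI)
    fix s t assume st: "s \<in> D_nodes r" "t \<in> D_nodes r" "D_root r s = D_root r t"
    then have "D_fst r s = D_fst r t \<and> D_snd r s = D_snd r t \<or>
      D_fst r s = D_snd r t \<and> D_snd r s = D_fst r t"
      by (simp add: D_root_def doubleton_eq_iff)
    then show "s = t" using st r
      by (cases "s = r"; cases "t = r") (auto simp: D_fst_def D_snd_def D_nodes_def)
  qed
  show "D_ht r (D_root r s) = 1" if "s \<in> D_nodes r" for s
    using coord_ht_simple[OF r that] D_fst_snd[OF r that] by (simp add: D_root_def D_ht_pair)
  fix \<beta> assume "\<beta> \<in> D_roots r"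
  then obtain a b where \<beta>: "\<beta> = {a, b}" and ab: "1 \<le> \<bar>a\<bar>" "\<bar>a\<bar> \<le> int r" "1 \<le> \<bar>b\<bar>" "\<bar>b\<bar> \<le> int r"
    "\<bar>a\<bar> \<noteq> \<bar>b\<bar>" by (auto simp: D_roots_def)
  have "a \<noteq> b" using ab by auto
  \<comment> \<open>The numbers r - |a| and r - |b| are distinct and nonnegative, so neither their
    sum nor their difference vanishes.\<close>
  show "D_ht r \<beta> \<noteq> 0" using \<beta> ab by (auto simp: D_ht_pair coord_ht_def sgn_if abs_if split: if_splits)
  show "uminus ` \<beta> \<in> D_roots r" unfolding D_roots_def using ab
    by (intro CollectI exI[of _ "- a"] exI[of _ "- b"]) (auto simp: \<beta>)
  show "uminus ` uminus ` \<beta> = \<beta>" by (simp add: \<beta>)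
  show "D_ht r (uminus ` \<beta>) = - D_ht r \<beta>"
    using ab \<open>a \<noteq> b\<close> by (simp add: \<beta> D_ht_pair coord_ht_minus)
  {
    fix s assume s: "s \<in> D_nodes r"
    show "D_act r s ` \<beta> \<in> D_roots r" unfolding D_roots_def
      using abs_D_act_range[OF r s, of a] abs_D_act_range[OF r s, of b] ab
      by (intro CollectI exI[of _ "D_act r s a"] exI[of _ "D_act r s b"])
        (auto simp: \<beta> abs_D_act_eq_iff)
    show "D_act r s ` uminus ` \<beta> = uminus ` D_act r s ` \<beta>"
      by (simp add: \<beta> D_act_minus r s)
    show "D_act r s ` D_act r s ` \<beta> = \<beta>" by (simp add: \<beta> D_act_D_act r s)
    show "\<beta> = D_root r s" if "0 < D_ht r \<beta>" "D_ht r (D_act r s ` \<beta>) < 0"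
    proof -
      have "D_act r s a \<noteq> D_act r s b" using abs_D_act_eq_iff ab(5) by metis
      then have "coord_ht r (D_act r s a) + coord_ht r (D_act r s b) < 0"
        "0 < coord_ht r a + coord_ht r b"
        using that \<open>a \<noteq> b\<close> by (simp_all add: \<beta> D_ht_pair)
      \<comment> \<open>The height drops from at least 1 to at most -1, and each coordinate loses at
        most 1; so both coordinates must lose 1.\<close>
      then have "a \<in> {D_fst r s, D_snd r s}" "b \<in> {D_fst r s, D_snd r s}"
        unfolding coord_ht_D_act[OF r s] by (auto split: if_splits)
      then show ?thesis using \<open>a \<noteq> b\<close> by (auto simp: \<beta> D_root_def)
    qed
    fix t assume t: "t \<in> D_nodes r"
    show "foldr (\<lambda>t. (`) (D_act r t)) (concat (replicate (D_matrix r s t) [s, t])) \<beta> = \<beta>"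
      using D_act_relator[OF r s t] by (simp add: foldr_image)
  }
next
  fix s assume s: "s \<in> D_nodes r"
  show "D_root r s \<in> D_roots r" by (rule D_root_D_roots[OF r s])
  show "D_act r s ` D_root r s = uminus ` D_root r s"
    by (simp add: D_root_def D_act_def reflect_fst reflect_snd insert_commute)
  fix t assume t: "t \<in> D_nodes r"
  show "D_act r s ` D_root r t = D_root r t" if "D_matrix r s t = 2"
    using D_matrix_2[OF r s t that]
  proof
    assume "{\<bar>D_fst r s\<bar>, \<bar>D_snd r s\<bar>} \<inter> {\<bar>D_fst r t\<bar>, \<bar>D_snd r t\<bar>} = {}"
    then show ?thesis by (simp add: D_root_def D_act_def reflect_other)
  next
    assume "D_fst r s = D_fst r t \<and> D_snd r s = - D_snd r t"
    then show ?thesis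
      using reflect_fst[of "D_fst r s" "D_snd r s"] reflect_minus[of "D_fst r s" "D_snd r s" "D_snd r s"]
        reflect_snd[of "D_fst r s" "D_snd r s"] D_fst_snd[OF r s]
      by (auto simp: D_root_def D_act_def)
  qed
  assume m: "D_matrix r s t = 3"
  obtain x y z where h: "D_act r s = reflect x y" "D_root r s = {x, y}"
    "D_act r t = reflect (- y) z" "D_root r t = {- y, z}"
    "x \<noteq> 0" "y \<noteq> 0" "z \<noteq> 0" "\<bar>x\<bar> \<noteq> \<bar>y\<bar>" "\<bar>y\<bar> \<noteq> \<bar>z\<bar>" "\<bar>x\<bar> \<noteq> \<bar>z\<bar>"
    using D_matrix_3[OF r s t m] .
  have img: "D_act r s ` D_root r t = {x, z}"
    using reflect_minus[OF h(5,6,8), of y] reflect_other[of z x y] h(5-)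
    by (simp add: h reflect_snd)
  have "D_act r t x = x" using reflect_other[of x "- y" z] h(5-) by (simp add: h)
  then show "D_act r t ` D_act r s ` D_root r t = D_root r s"
    unfolding img by (simp add: h reflect_snd)
  fix u assume u: "u \<in> lists (D_nodes r)"
  let ?f = "foldr (D_act r) u"
  \<comment> \<open>Roots are sets, so a height splits into the heights of two coordinates only if
    these are distinct. After splitting, the terms for \<open>y\<close> and \<open>- y\<close>
    cancel.\<close>
  have "?f x \<noteq> ?f z" "?f x \<noteq> ?f y" "?f (- y) \<noteq> ?f z"
    using h(5-) abs_foldr_D_act_eq_iff[of r u] by (metis abs_minus_cancel)+
  then show "D_ht r (foldr (\<lambda>t. (`) (D_act r t)) u (D_act r s ` D_root r t)) =
    D_ht r (foldr (\<lambda>t. (`) (D_act r t)) u (D_root r s)) +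
    D_ht r (foldr (\<lambda>t. (`) (D_act r t)) u (D_root r t))"
    unfolding img unfolding h
    by (simp add: foldr_image D_ht_pair foldr_D_act_minus[OF r u] coord_ht_minus)
qed

section \<open>Even signed permutations and words for them\<close>

definition D_perm :: "nat \<Rightarrow> nat \<Rightarrow> (int \<Rightarrow> int) \<Rightarrow> bool" where
  "D_perm j r f \<longleftrightarrow> bij f \<and> (\<forall>a. f (- a) = - f a) \<and>
    (\<forall>a. \<bar>a\<bar> < int j \<or> int r < \<bar>a\<bar> \<longrightarrow> f a = a) \<and> (\<Prod>a\<in>{1..int r}. sgn (f a)) = 1"

lemma D_permD:
  assumes "D_perm j r f"
  shows "bij f" "inj f" "f (- a) = - f a" "\<bar>a\<bar> < int j \<Longrightarrow> f a = a" "int r < \<bar>a\<bar> \<Longrightarrow> f a = a"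
    "(\<Prod>a\<in>{1..int r}. sgn (f a)) = 1"
  using assms by (auto simp: D_perm_def bij_is_inj)

lemma odd_inj_abs_eq_iff:
  fixes f :: "int \<Rightarrow> int"
  assumes "inj f" "\<And>a. f (- a) = - f a"
  shows "\<bar>f a\<bar> = \<bar>f b\<bar> \<longleftrightarrow> \<bar>a\<bar> = \<bar>b\<bar>"
  using assms by (metis abs_eq_iff injD)

lemma odd_zero:
  fixes f :: "int \<Rightarrow> int"
  assumes "\<And>a. f (- a) = - f a"
  shows "f 0 = 0"
  using assms[of 0] by simp

text \<open>An image outside the range would be fixed by \<open>f\<close>, and by injectivity it
  would equal its argument.\<close>

lemma odd_inj_abs_le:
  fixes f :: "int \<Rightarrow> int"
  assumes "inj f" and "\<And>a. k < \<bar>a\<bar> \<Longrightarrow> f a = a" and "\<bar>a\<bar> \<le> k"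
  shows "\<bar>f a\<bar> \<le> k"
  using assms by (metis injD not_le)

lemma odd_inj_abs_bij_betw:
  fixes f :: "int \<Rightarrow> int"
  assumes "inj f" "\<And>a. f (- a) = - f a" "\<And>a. k < \<bar>a\<bar> \<Longrightarrow> f a = a"
  shows "bij_betw (\<lambda>a. \<bar>f a\<bar>) {1..k} {1..k}"
proof -
  have "\<bar>f a\<bar> \<in> {1..k}" if "a \<in> {1..k}" for a
  proof -
    have "\<bar>f a\<bar> \<noteq> \<bar>f 0\<bar>" using odd_inj_abs_eq_iff[OF assms(1,2), of a 0] that by simp
    then show ?thesis
      using odd_inj_abs_le[of f k a, OF assms(1,3)] that odd_zero[of f, OF assms(2)] by auto
  qed
  moreover have "inj_on (\<lambda>a. \<bar>f a\<bar>) {1..k}"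
    by (rule inj_onI) (use odd_inj_abs_eq_iff[OF assms(1,2)] in auto)
  ultimately show ?thesis
    unfolding bij_betw_def
    using endo_inj_surj[of "{1..k}" "\<lambda>a. \<bar>f a\<bar>"] by (auto simp: image_subset_iff)
qed

text \<open>The sign of \<open>f (g a)\<close> is the sign of \<open>f\<close> at
  \<open>\<bar>g a\<bar>\<close> times the sign of \<open>g a\<close>; the first factor is reindexed
  by the permutation of absolute values that \<open>g\<close> induces.\<close>

lemma prod_sgn_comp:
  fixes f g :: "int \<Rightarrow> int"
  assumes f: "\<And>a. f (- a) = - f a"
    and g: "inj g" "\<And>a. g (- a) = - g a" "\<And>a. k < \<bar>a\<bar> \<Longrightarrow> g a = a"
  shows "(\<Prod>a\<in>{1..k}. sgn (f (g a))) = (\<Prod>a\<in>{1..k}. sgn (f a)) * (\<Prod>a\<in>{1..k}. sgn (g a))"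
proof -
  have "sgn (f (g a)) = sgn (f \<bar>g a\<bar>) * sgn (g a)" for a
    using f[of "g a"] odd_zero[of f, OF f] by (simp add: abs_if sgn_if)
  then have "(\<Prod>a\<in>{1..k}. sgn (f (g a))) = (\<Prod>a\<in>{1..k}. sgn (f \<bar>g a\<bar>) * sgn (g a))"
    by simp
  also have "\<dots> = (\<Prod>a\<in>{1..k}. sgn (f \<bar>g a\<bar>)) * (\<Prod>a\<in>{1..k}. sgn (g a))"
    by (rule prod.distrib)
  also have "(\<Prod>a\<in>{1..k}. sgn (f \<bar>g a\<bar>)) = (\<Prod>a\<in>{1..k}. sgn (f a))"
    using prod.reindex_bij_betw[OF odd_inj_abs_bij_betw[OF g], where g = "\<lambda>a. sgn (f a)"] .
  finally show ?thesis .
qed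

lemma D_perm_id: "D_perm j r id"
  by (auto simp: D_perm_def intro!: prod.neutral)

lemma D_perm_comp: "D_perm j r f \<Longrightarrow> D_perm j r g \<Longrightarrow> D_perm j r (f \<circ> g)"
  using prod_sgn_comp[of f g "int r"] by (auto simp: D_perm_def bij_comp bij_is_inj)

lemma D_perm_D_act:
  assumes r: "4 \<le> r" and j: "1 \<le> j" "j < r" and t: "j \<le> t" "t \<le> r"
  shows "D_perm j r (D_act r t)"
proof -
  have tn: "t \<in> D_nodes r" using j t by (simp add: D_nodes_def)
  have "bij (D_act r t)"
    using D_act_D_act[OF r tn] by (rule involuntory_imp_bij)
  moreover have "D_act r t a = a" if "\<bar>a\<bar> < int j \<or> int r < \<bar>a\<bar>" for a
    using that j t by (auto simp: D_act_def D_fst_def D_snd_def intro!: reflect_other)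
  \<comment> \<open>Node \<open>r\<close> changes two signs; the other nodes exchange two
    coordinates without changing signs.\<close>
  moreover have "(\<Prod>a\<in>{1..int r}. sgn (D_act r t a)) = 1"
  proof (cases "t = r")
    case True
    have "(\<Prod>a\<in>{1..int r}. sgn (D_act r t a)) =
        (\<Prod>a\<in>{int r - 1, int r}. sgn (D_act r t a))"
      using r True
      by (intro prod.mono_neutral_right) (auto simp: D_act_def D_fst_def D_snd_def reflect_def)
    also have "\<dots> = 1"
      using r by (simp add: True D_act_def D_fst_def D_snd_def reflect_fst reflect_snd)
    finally show ?thesis .
  next
    case False
    then show ?thesis using j t
      by (intro prod.neutral) (auto simp: D_act_def D_fst_def D_snd_def reflect_def)
  qed
  ultimately show ?thesis using D_act_minus[OF r tn] by (simp add: D_perm_def)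
qed

text \<open>Together with \<open>D_perm_word\<close>, this identifies \<open>D_perm j r\<close> with
  the action of the parabolic subgroup of the nodes \<open>j\<close> to \<open>r\<close>. The case
  \<open>j = 1\<close> is the whole group, and larger \<open>j\<close> serve the sets
  \<open>J_set\<close>.\<close>

lemma D_perm_foldr:
  assumes "4 \<le> r" "1 \<le> j" "j < r" "u \<in> lists {j..r}"
  shows "D_perm j r (foldr (D_act r) u)"
  using assms(4)
proof (induction u)
  case Nil
  then show ?case using D_perm_id by (simp add: id_def)
next
  case (Cons t u)
  then show ?case using D_perm_comp[OF D_perm_D_act[of r j t]] assms by (simp add: comp_def)
qed

text \<open>Positivity on the simple roots makes the heights \<open>h i\<close> strictly decreasing,
  with \<open>h (r - 1)\<close> positive. Counting down from the end gives r - i as a lower bound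
  for \<open>h i\<close>; counting up from \<open>h j\<close>, which is at most r - j because
  \<open>f\<close> preserves the range of coordinates, gives the same upper bound. So
  \<open>f\<close> fixes every coordinate below \<open>r\<close>.\<close>

lemma D_perm_eq_id:
  assumes f: "D_perm j r f" and j: "1 \<le> j" "j < r"
    and pos: "\<And>t. j \<le> t \<Longrightarrow> t \<le> r \<Longrightarrow> 0 < D_ht r (f ` D_root r t)"
  shows "f = id"
proof -
  note f_abs = odd_inj_abs_eq_iff[OF D_permD(2,3)[OF f]]
  define h where "h i = coord_ht r (f (int i))" for i
  have root: "D_ht r (f ` D_root r t) = coord_ht r (f (D_fst r t)) + coord_ht r (f (D_snd r t))"
    if "j \<le> t" "t \<le> r" for t
  proof -
    have "\<bar>D_fst r t\<bar> \<noteq> \<bar>D_snd r t\<bar>" using that j by (auto simp: D_fst_def D_snd_def)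
    then have "f (D_fst r t) \<noteq> f (D_snd r t)" using f_abs by metis
    then show ?thesis by (simp add: D_root_def D_ht_pair)
  qed
  have neg: "f (- int t - 1) = - f (int (Suc t))" for t
  proof -
    have "- int t - 1 = - int (Suc t)" by simp
    then show ?thesis by (simp only: D_permD(3)[OF f])
  qed
  have h_step: "h (Suc t) < h t" if "j \<le> t" "t < r" for t
    using pos[of t] root[of t] that neg[of t]
    by (simp add: h_def D_fst_def D_snd_def coord_ht_minus)
  have "0 < h (r - 1) + h r"
    using pos[of r] root[of r] j by (simp add: h_def D_fst_def D_snd_def of_nat_diff)
  \<comment> \<open>The roots of the nodes r-1 and r put \<open>h (r - 1)\<close> above both
    \<open>h r\<close> and \<open>- h r\<close>.\<close>
  then have last: "0 < h (r - 1)" using h_step[of "r - 1"] j by fastforce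
  have range: "int j \<le> \<bar>f (int i)\<bar> \<and> \<bar>f (int i)\<bar> \<le> int r" if "j \<le> i" "i \<le> r" for i
  proof -
    have "\<bar>f (int i)\<bar> \<le> int r"
      using odd_inj_abs_le[of f "int r" "int i", OF D_permD(2,5)[OF f]] that by simp
    moreover have "f (f (int i)) = f (int i) \<longrightarrow> f (int i) = int i"
      using D_permD(2)[OF f] by (auto dest: injD)
    ultimately show ?thesis using D_permD(4)[OF f, of "f (int i)"] that by force
  qed
  have lower: "int r - int i \<le> h i" if "j \<le> i" "i \<le> r - 1" for i
    using that(2,1)
  proof (induction i rule: inc_induct)
    case base
    then show ?case using last j by (simp add: of_nat_diff)
  next
    case (step i)
    then have "i < r" by simp
    then show ?case using h_step[of i] step by simp
  qed
  have upper: "h i \<le> int r - int i" if "j \<le> i" "i \<le> r - 1" for i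
    using that
  proof (induction i rule: dec_induct)
    case base
    have "h j \<le> int r - \<bar>f (int j)\<bar>" using range[of j] j
      by (cases "f (int j)" "0 :: int" rule: linorder_cases) (auto simp: h_def coord_ht_def)
    then show ?case using range[of j] j by simp
  next
    case (step i)
    then have "i < r" by simp
    then show ?case using h_step[of i] step by simp
  qed
  have fix_below: "f (int i) = int i" if "j \<le> i" "i < r" for i
  proof -
    have "coord_ht r (f (int i)) = int r - int i"
      unfolding h_def[symmetric] using that by (intro order_antisym upper lower) simp_all
    then show ?thesis using range[of i] that
      by (cases "f (int i)" "0 :: int" rule: linorder_cases) (auto simp: coord_ht_def)
  qed
  have fix_less: "f a = a" if "0 \<le> a" "a < int r" for a
    using that fix_below[of "nat a"] D_permD(4)[OF f, of a] by (cases "nat a < j") auto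
  have "\<bar>f (int r)\<bar> = int r"
  proof (rule ccontr)
    assume "\<bar>f (int r)\<bar> \<noteq> int r"
    then have "\<bar>f (int r)\<bar> < int r" using range[of r] j by simp
    then have "\<bar>f \<bar>f (int r)\<bar>\<bar> = \<bar>f (int r)\<bar>" using fix_less[of "\<bar>f (int r)\<bar>"] by simp
    then show False using f_abs \<open>\<bar>f (int r)\<bar> < int r\<close> by simp
  qed
  \<comment> \<open>Coordinate \<open>r\<close> has height 0, so heights cannot detect this sign;
    the parity condition decides it.\<close>
  moreover have "sgn (f (int r)) = 1"
  proof -
    have "{1..int r} = insert (int r) {1..int r - 1}" using j by auto
    then have "(\<Prod>a\<in>{1..int r}. sgn (f a)) = sgn (f (int r)) * (\<Prod>a\<in>{1..int r - 1}. sgn (f a))"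
      by simp
    also have "(\<Prod>a\<in>{1..int r - 1}. sgn (f a)) = 1"
      using fix_less by (intro prod.neutral) auto
    finally show ?thesis using D_permD(6)[OF f] by simp
  qed
  ultimately have "f (int r) = int r" by (auto simp: sgn_if split: if_splits)
  then have nonneg: "f a = a" if "0 \<le> a" for a
    using that fix_less[of a] D_permD(5)[OF f, of a] by (cases a "int r" rule: linorder_cases) auto
  show ?thesis
  proof
    fix a
    show "f a = id a" using nonneg[of a] nonneg[of "- a"] D_permD(3)[OF f, of "- a"]
      by (cases "0 \<le> a") auto
  qed
qed

text \<open>Sorting: as long as a simple root of a node in \<open>j..r\<close> is negated, composing
  with its reflection removes one inversion. When none is left, the map is the identity.\<close>

lemma D_perm_word:
  assumes r: "4 \<le> r" and j: "1 \<le> j" "j < r" and f: "D_perm j r f"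
  obtains u where "u \<in> lists {j..r}" "foldr (D_act r) u = f"
proof -
  interpret simply_laced_action "D_nodes r" "D_matrix r" "D_roots r"
    "(`) uminus" "\<lambda>t. (`) (D_act r t)" "D_root r" "D_ht r"
    by (rule D_simply_laced_action[OF r])
  have "\<exists>u\<in>lists {j..r}. foldr (D_act r) u = f" using f
  proof (induction "card (inversions ((`) f))" arbitrary: f rule: less_induct)
    case less
    have mem: "f ` D_root r t \<in> D_roots r" if "t \<in> D_nodes r" for t
    proof -
      have "1 \<le> \<bar>f a\<bar> \<and> \<bar>f a\<bar> \<le> int r" if "1 \<le> \<bar>a\<bar>" "\<bar>a\<bar> \<le> int r" for a
        using that odd_inj_abs_le[of f "int r" a, OF D_permD(2,5)[OF less.prems]]
          odd_inj_abs_eq_iff[OF D_permD(2,3)[OF less.prems], of a 0]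
          odd_zero[of f, OF D_permD(3)[OF less.prems]] by auto
      then show ?thesis
        unfolding D_roots_def D_root_def
        using D_fst_snd[OF r that] odd_inj_abs_eq_iff[OF D_permD(2,3)[OF less.prems]]
        by (intro CollectI exI[of _ "f (D_fst r t)"] exI[of _ "f (D_snd r t)"]) auto
    qed
    show ?case
    proof (cases "\<exists>t\<in>{j..r}. D_ht r (f ` D_root r t) < 0")
      case True
      then obtain t where t: "t \<in> {j..r}" "D_ht r (f ` D_root r t) < 0" by blast
      then have tn: "t \<in> D_nodes r" using j by (simp add: D_nodes_def)
      have "card (inversions ((`) f)) = Suc (card (inversions ((`) f \<circ> (`) (D_act r t))))"
        using t(2) mem[OF tn] D_permD(3)[OF less.prems]
        by (intro card_inversions_down[OF tn]) (auto simp: image_image)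
      moreover have "(`) f \<circ> (`) (D_act r t) = (`) (f \<circ> D_act r t)" by (auto simp: image_image)
      moreover have p: "D_perm j r (f \<circ> D_act r t)"
        using less.prems D_perm_D_act[OF r j] t by (intro D_perm_comp) auto
      ultimately obtain u where u: "u \<in> lists {j..r}" "foldr (D_act r) u = f \<circ> D_act r t"
        using less.hyps[OF _ p] by auto
      have "foldr (D_act r) (u @ [t]) = f"
        using u(2) D_act_D_act[OF r tn] by (auto simp: fun_eq_iff)
      moreover have "u @ [t] \<in> lists {j..r}" using u t by simp
      ultimately show ?thesis by blast
    next
      case False
      have "f = id"
      proof (rule D_perm_eq_id[OF less.prems j])
        fix t assume t: "j \<le> t" "t \<le> r"
        then have "t \<in> D_nodes r" using j by (simp add: D_nodes_def)
        then show "0 < D_ht r (f ` D_root r t)"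
          using False t ht_nonzero[OF mem] by force
      qed
      then show ?thesis by (intro bexI[of _ "[]"]) auto
    qed
  qed
  then show thesis using that by blast
qed

section \<open>The isomorphism from the presented group to the even signed permutations\<close>

definition D_perm_of :: "nat \<Rightarrow> nat list set \<Rightarrow> int \<Rightarrow> int" where
  "D_perm_of r x = foldr (D_act r) (SOME u. u \<in> x)"

abbreviation D_class :: "nat \<Rightarrow> nat list \<Rightarrow> nat list set" where
  "D_class r \<equiv> cox_class (D_nodes r) (D_matrix r)"

text \<open>All words of a class act alike, so the representative chosen in \<open>D_perm_of\<close>
  does not matter.\<close>

lemma D_perm_of_class:
  assumes r: "4 \<le> r" and u: "u \<in> lists (D_nodes r)"
  shows "D_perm_of r (D_class r u) = foldr (D_act r) u"
proof -
  have "u \<in> D_class r u" using u by (simp add: cox_class_def cox_rel_def cox_equiv.refl)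
  then have "(SOME v. v \<in> D_class r u) \<in> D_class r u" by (rule someI)
  then have e: "cox_equiv (D_nodes r) (D_matrix r) u (SOME v. v \<in> D_class r u)"
    by (simp add: cox_class_def cox_rel_def)
  show ?thesis
    unfolding D_perm_of_def
    using foldr_cox_equiv[OF e, of UNIV "D_act r"] D_act_relator[OF r] by auto
qed

lemma carrier_W_D: "carrier (W_D r) = D_class r ` lists (D_nodes r)"
  by (simp add: W_D_def carrier_coxeter_group)

lemma group_W_D: "group (W_D r)"
  unfolding W_D_def by (rule group_coxeter_group) (simp add: D_matrix_def)

lemma D_perm_of_mult:
  assumes "4 \<le> r" "x \<in> carrier (W_D r)" "y \<in> carrier (W_D r)"
  shows "D_perm_of r (x \<otimes>\<^bsub>W_D r\<^esub> y) = D_perm_of r x \<circ> D_perm_of r y"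
proof -
  obtain u v where "u \<in> lists (D_nodes r)" "x = D_class r u" "v \<in> lists (D_nodes r)" "y = D_class r v"
    using assms by (auto simp: carrier_W_D)
  then show ?thesis
    using assms(1) D_perm_of_class[of r "u @ v"]
    by (simp add: W_D_def mult_coxeter_group D_perm_of_class fun_eq_iff)
qed

lemma D_perm_of_one: "4 \<le> r \<Longrightarrow> D_perm_of r \<one>\<^bsub>W_D r\<^esub> = id"
  by (simp add: W_D_def one_coxeter_group D_perm_of_class)

lemma D_perm_D_perm_of:
  assumes "4 \<le> r" "x \<in> carrier (W_D r)"
  shows "D_perm 1 r (D_perm_of r x)"
proof -
  obtain u where u: "u \<in> lists (D_nodes r)" "x = D_class r u" using assms by (auto simp: carrier_W_D)
  then have "D_perm 1 r (foldr (D_act r) u)"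
    using assms(1) by (intro D_perm_foldr) (auto simp: D_nodes_def)
  then show ?thesis using D_perm_of_class[OF assms(1) u(1)] u(2) by simp
qed

lemma D_perm_of_inj:
  assumes r: "4 \<le> r" and xy: "x \<in> carrier (W_D r)" "y \<in> carrier (W_D r)" "D_perm_of r x = D_perm_of r y"
  shows "x = y"
proof -
  interpret simply_laced_action "D_nodes r" "D_matrix r" "D_roots r"
    "(`) uminus" "\<lambda>t. (`) (D_act r t)" "D_root r" "D_ht r"
    by (rule D_simply_laced_action[OF r])
  obtain u v where uv: "u \<in> lists (D_nodes r)" "x = D_class r u" "v \<in> lists (D_nodes r)" "y = D_class r v"
    using xy by (auto simp: carrier_W_D)
  then have "foldr (D_act r) u = foldr (D_act r) v" using xy D_perm_of_class[OF r] by simp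
  then have "foldr (\<lambda>t. (`) (D_act r t)) u = foldr (\<lambda>t. (`) (D_act r t)) v"
    by (simp add: foldr_image fun_eq_iff)
  then show ?thesis using uv equ_if_inversions_eq[of u v] by (simp add: cox_class_eq_iff)
qed

lemma D_perm_of_surj:
  assumes r: "4 \<le> r" and "D_perm 1 r f"
  obtains x where "x \<in> carrier (W_D r)" "D_perm_of r x = f"
proof -
  obtain u where "u \<in> lists {1..r}" "foldr (D_act r) u = f"
    using D_perm_word[of r 1 f] assms by auto
  then show thesis
    using that[of "D_class r u"] D_perm_of_class[OF r, of u] by (simp add: carrier_W_D D_nodes_def)
qed

text \<open>The condition \<open>negate\<close> asks for negated heights, not negated roots: a
  longest element may fix coordinate r, and then e_a + e_r goes to -e_a + e_r, whose height is still
  the negative one because coordinate r has height 0.\<close>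

lemma D_perm_of_longest:
  assumes r: "4 \<le> r" and I: "I \<subseteq> D_nodes r" and u: "u \<in> lists I" and P: "P \<subseteq> D_roots r"
    and root_P: "\<And>s. s \<in> I \<Longrightarrow> D_root r s \<in> P"
    and act_P: "\<And>s \<beta>. s \<in> I \<Longrightarrow> \<beta> \<in> P \<Longrightarrow> D_act r s ` \<beta> \<in> P"
    and negate: "\<And>\<beta>. \<beta> \<in> P \<Longrightarrow> D_ht r (foldr (D_act r) u ` \<beta>) = - D_ht r \<beta>"
  shows "longest_D r I \<in> carrier (W_D r)" "D_perm_of r (longest_D r I) = foldr (D_act r) u"
proof -
  interpret simply_laced_action "D_nodes r" "D_matrix r" "D_roots r"
    "(`) uminus" "\<lambda>t. (`) (D_act r t)" "D_root r" "D_ht r"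
    by (rule D_simply_laced_action[OF r])
  have "u \<in> lists (D_nodes r)" using u I by auto
  moreover have "longest_D r I = D_class r u"
    unfolding longest_D_def
    by (rule longest_element_eq[OF I u P]) (simp_all add: root_P act_P negate foldr_image)
  ultimately show "longest_D r I \<in> carrier (W_D r)" "D_perm_of r (longest_D r I) = foldr (D_act r) u"
    using D_perm_of_class[OF r] by (auto simp: carrier_W_D)
qed

section \<open>Conjugacy of odd involutions\<close>

lemma odd_sgn:
  fixes f :: "int \<Rightarrow> int"
  assumes "\<And>a. f (- a) = - f a"
  shows "f c = sgn c * f \<bar>c\<bar>"
  using assms[of c] assms[of 0] by (cases c "0 :: int" rule: linorder_cases) auto

lemma odd_sgn_mult:
  fixes f :: "int \<Rightarrow> int"
  assumes "\<And>a. f (- a) = - f a"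
  shows "f (sgn b * c) = sgn b * f c"
  using assms[of c] assms[of 0] by (cases b "0 :: int" rule: linorder_cases) auto

definition moved :: "int \<Rightarrow> (int \<Rightarrow> int) \<Rightarrow> int set" where
  "moved n f = {a \<in> {1..n}. \<bar>f a\<bar> \<noteq> \<bar>a\<bar>}"

definition negated :: "int \<Rightarrow> (int \<Rightarrow> int) \<Rightarrow> int set" where
  "negated n f = {a \<in> {1..n}. f a = - a}"

text \<open>For an involution, each pair of coordinates exchanged up to sign has one ascent and one
  descent; the ascent serves as its representative.\<close>

definition ascents :: "int \<Rightarrow> (int \<Rightarrow> int) \<Rightarrow> int set" where
  "ascents n f = {a \<in> {1..n}. a < \<bar>f a\<bar>}"

definition descents :: "int \<Rightarrow> (int \<Rightarrow> int) \<Rightarrow> int set" where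
  "descents n f = {a \<in> {1..n}. \<bar>f a\<bar> < a}"

definition fixed :: "int \<Rightarrow> (int \<Rightarrow> int) \<Rightarrow> int set" where
  "fixed n f = {a \<in> {1..n}. f a = a}"

lemma finite_cycle_types [simp]:
  "finite (moved n f)" "finite (negated n f)" "finite (ascents n f)" "finite (descents n f)"
  "finite (fixed n f)"
  by (rule finite_subset[of _ "{1..n}"];
      force simp: moved_def negated_def ascents_def descents_def fixed_def)+

locale odd_involution =
  fixes n :: int and f :: "int \<Rightarrow> int"
  assumes odd: "f (- a) = - f a"
    and invol: "f (f a) = a"
    and range: "a \<in> {1..n} \<Longrightarrow> \<bar>f a\<bar> \<in> {1..n}"
begin

lemma abs_f_abs: "\<bar>f \<bar>a\<bar>\<bar> = \<bar>f a\<bar>"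
  by (simp add: abs_if odd)

lemma abs_invol: "\<bar>f \<bar>f a\<bar>\<bar> = \<bar>a\<bar>"
  by (simp add: abs_f_abs invol)

lemma f_abs_f: "f \<bar>f a\<bar> = sgn (f a) * a"
  using odd_sgn[of f "f a"] odd invol by (simp add: sgn_if split: if_splits)

lemma bij_betw_descents: "bij_betw (\<lambda>a. \<bar>f a\<bar>) (ascents n f) (descents n f)"
  by (rule bij_betw_byWitness[of _ "\<lambda>a. \<bar>f a\<bar>"])
    (use range abs_invol in \<open>auto simp: ascents_def descents_def\<close>)

lemma bij_betw_ascents: "bij_betw (\<lambda>a. \<bar>f a\<bar>) (descents n f) (ascents n f)"
  by (rule bij_betw_byWitness[of _ "\<lambda>a. \<bar>f a\<bar>"])
    (use range abs_invol in \<open>auto simp: ascents_def descents_def\<close>)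

lemma cases_sign:
  assumes "a \<in> {1..n}"
  obtains "a \<in> ascents n f" | "a \<in> descents n f" | "a \<in> fixed n f" | "a \<in> negated n f"
  using assms by (fastforce simp: ascents_def descents_def fixed_def negated_def)

lemma card_moved: "card (moved n f) = 2 * card (ascents n f)"
proof -
  have "moved n f = ascents n f \<union> descents n f"
    by (auto simp: moved_def ascents_def descents_def)
  moreover have "card (ascents n f \<union> descents n f) = card (ascents n f) + card (descents n f)"
    by (intro card_Un_disjoint finite_UnI finite_cycle_types) (auto simp: ascents_def descents_def)
  ultimately show ?thesis using bij_betw_same_card[OF bij_betw_descents] by simp
qed

lemma card_sum: "card (moved n f) + card (negated n f) + card (fixed n f) = nat n"
proof -
  have "{1..n} = moved n f \<union> (negated n f \<union> fixed n f)"
    by (auto simp: moved_def negated_def fixed_def)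
  then have "nat n = card (moved n f \<union> (negated n f \<union> fixed n f))" by (metis card_atLeastAtMost_int diff_add_cancel)
  also have "\<dots> = card (moved n f) + card (negated n f \<union> fixed n f)"
    by (intro card_Un_disjoint finite_UnI finite_cycle_types) (auto simp: moved_def negated_def fixed_def)
  also have "card (negated n f \<union> fixed n f) = card (negated n f) + card (fixed n f)"
    by (intro card_Un_disjoint finite_UnI finite_cycle_types) (auto simp: negated_def fixed_def)
  finally show ?thesis by simp
qed

end

text \<open>Absolute values separate arguments up to sign, and oddness settles the sign because no
  value of \<open>\<gamma>\<close> on 1..n is 0. Surjectivity comes from finiteness of the interval
  -n..n.\<close>

lemma odd_extension_bij:
  fixes \<gamma> :: "int \<Rightarrow> int" and n :: int
  assumes rng: "\<And>a. a \<in> {1..n} \<Longrightarrow> \<bar>\<gamma> a\<bar> \<in> {1..n}" and inj: "inj_on (\<lambda>a. \<bar>\<gamma> a\<bar>) {1..n}"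
  shows "bij (\<lambda>a. if \<bar>a\<bar> \<le> n then sgn a * \<gamma> \<bar>a\<bar> else a)"
proof -
  define g where "g a = (if \<bar>a\<bar> \<le> n then sgn a * \<gamma> \<bar>a\<bar> else a)" for a
  have abs_g: "\<bar>g a\<bar> = (if a = 0 then 0 else \<bar>\<gamma> \<bar>a\<bar>\<bar>)" if "\<bar>a\<bar> \<le> n" for a
    using that by (simp add: g_def abs_mult abs_sgn_eq)
  have maps: "\<bar>g a\<bar> \<le> n" if "\<bar>a\<bar> \<le> n" for a
    unfolding abs_g[OF that] using that rng[of "\<bar>a\<bar>"] by auto
  have nz: "\<gamma> \<bar>a\<bar> \<noteq> 0" if "a \<noteq> 0" "\<bar>a\<bar> \<le> n" for a
    using rng[of "\<bar>a\<bar>"] that by force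
  have inj_g: "a = b" if "g a = g b" "\<bar>a\<bar> \<le> n" "\<bar>b\<bar> \<le> n" for a b
  proof -
    have eq: "(if a = 0 then 0 else \<bar>\<gamma> \<bar>a\<bar>\<bar>) = (if b = 0 then 0 else \<bar>\<gamma> \<bar>b\<bar>\<bar>)"
      using that abs_g[OF that(2)] abs_g[OF that(3)] by simp
    show ?thesis
    proof (cases "a = 0 \<or> b = 0")
      case True
      then show ?thesis using eq nz[of a] nz[of b] that(2,3) by (auto split: if_splits)
    next
      case False
      then have "1 \<le> \<bar>a\<bar>" "1 \<le> \<bar>b\<bar>" by auto
      then have ab: "\<bar>a\<bar> = \<bar>b\<bar>"
        using False eq that(2,3) inj_onD[OF inj, of "\<bar>a\<bar>" "\<bar>b\<bar>"] by simp
      have "sgn a * \<gamma> \<bar>b\<bar> = sgn b * \<gamma> \<bar>b\<bar>" using that by (simp add: g_def ab)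
      moreover have "\<gamma> \<bar>b\<bar> \<noteq> 0" using nz False that(3) by blast
      ultimately have "sgn a = sgn b" by simp
      then show ?thesis using ab by (metis sgn_mult_abs)
    qed
  qed
  have "inj g"
  proof (rule injI)
    fix a b assume eq: "g a = g b"
    consider "\<bar>a\<bar> \<le> n" "\<bar>b\<bar> \<le> n" | "\<bar>a\<bar> \<le> n" "n < \<bar>b\<bar>" | "n < \<bar>a\<bar>" "\<bar>b\<bar> \<le> n" | "n < \<bar>a\<bar>" "n < \<bar>b\<bar>"
      by linarith
    then show "a = b"
    proof cases
      case 1
      then show ?thesis using inj_g eq by blast
    next
      case 2
      then show ?thesis using maps[of a] eq by (simp add: g_def)
    next
      case 3
      then show ?thesis using maps[of b] eq by (simp add: g_def)
    next
      case 4
      then show ?thesis using eq by (simp add: g_def)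
    qed
  qed
  moreover have "g ` {- n..n} = {- n..n}"
  proof (rule endo_inj_surj)
    show "g ` {- n..n} \<subseteq> {- n..n}" using maps by (fastforce simp: abs_le_iff)
    show "inj_on g {- n..n}" using \<open>inj g\<close> by (rule inj_on_subset) simp
  qed simp
  then have "b \<in> range g" for b
  proof (cases "\<bar>b\<bar> \<le> n")
    case True
    then have "b \<in> {- n..n}" by auto
    then show ?thesis using \<open>g ` {- n..n} = {- n..n}\<close> by blast
  next
    case False
    then have "g b = b" by (simp add: g_def)
    then show ?thesis by (metis rangeI)
  qed
  ultimately have "bij g" by (auto simp: bij_def)
  then show ?thesis by (simp add: g_def[abs_def])
qed

text \<open>Match fixed with fixed, negated with negated and ascents with ascents, arbitrarily; the
  equation then dictates \<open>g\<close> on descents. Since \<open>g\<close> may introduce signs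
  there, exchanges with and without a sign change are conjugate, and numbers alone decide.\<close>

lemma odd_involution_conjugator:
  assumes f: "odd_involution n f" and f': "odd_involution n f'"
    and m: "card (moved n f) = card (moved n f')"
    and q: "card (negated n f) = card (negated n f')"
  obtains g where "bij g" "\<And>a. g (- a) = - g a" "\<And>a. n < \<bar>a\<bar> \<Longrightarrow> g a = a"
    "\<And>a. \<bar>a\<bar> \<le> n \<Longrightarrow> g (f a) = f' (g a)"
proof -
  interpret F: odd_involution n f by (rule f)
  interpret F': odd_involution n f' by (rule f')
  have ca: "card (ascents n f) = card (ascents n f')" using F.card_moved F'.card_moved m by simp
  obtain e where e: "bij_betw e (ascents n f) (ascents n f')"
    using finite_same_card_bij[OF finite_cycle_types(3,3) ca] by blast
  have cf: "card (fixed n f) = card (fixed n f')" using F.card_sum F'.card_sum m q by simp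
  obtain e1 where e1: "bij_betw e1 (fixed n f) (fixed n f')"
    using finite_same_card_bij[OF finite_cycle_types(5,5) cf] by blast
  obtain e2 where e2: "bij_betw e2 (negated n f) (negated n f')"
    using finite_same_card_bij[OF finite_cycle_types(2,2) q] by blast
  \<comment> \<open>The value at a descent \<open>a\<close> is forced: \<open>a = f (f a)\<close>
    requires \<open>g a = f' (g (f a))\<close>, and \<open>f a\<close> is its sign times the ascent
    \<open>\<bar>f a\<bar>\<close>.\<close>
  define \<gamma> where "\<gamma> a = (if a \<in> ascents n f then e a
    else if a \<in> descents n f then sgn (f a) * f' (e \<bar>f a\<bar>)
    else if a \<in> fixed n f then e1 a else e2 a)" for a
  have \<gamma>_asc: "\<gamma> a = e a" "\<gamma> a \<in> ascents n f'" if "a \<in> ascents n f" for a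
    using that bij_betwE[OF e] by (auto simp: \<gamma>_def)
  have \<gamma>_fix: "\<gamma> a = e1 a" "\<gamma> a \<in> fixed n f'" if "a \<in> fixed n f" for a
    using that bij_betwE[OF e1] by (auto simp: \<gamma>_def ascents_def descents_def fixed_def)
  have \<gamma>_neg: "\<gamma> a = e2 a" "\<gamma> a \<in> negated n f'" if "a \<in> negated n f" for a
    using that bij_betwE[OF e2]
    by (auto simp: \<gamma>_def ascents_def descents_def fixed_def negated_def)
  have desc_asc: "\<bar>f a\<bar> \<in> ascents n f" if "a \<in> descents n f" for a
    using that F.range[of a] F.abs_invol[of a] by (auto simp: ascents_def descents_def)
  have \<gamma>_desc: "\<gamma> a = sgn (f a) * f' (e \<bar>f a\<bar>)" "\<bar>\<gamma> a\<bar> = \<bar>f' (e \<bar>f a\<bar>)\<bar>" "\<bar>\<gamma> a\<bar> \<in> descents n f'"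
    if a: "a \<in> descents n f" for a
  proof -
    show 1: "\<gamma> a = sgn (f a) * f' (e \<bar>f a\<bar>)" using a by (auto simp: \<gamma>_def ascents_def descents_def)
    have "f a \<noteq> 0" using F.range[of a] a by (auto simp: descents_def)
    then show 2: "\<bar>\<gamma> a\<bar> = \<bar>f' (e \<bar>f a\<bar>)\<bar>" by (simp add: 1 abs_mult abs_sgn_eq)
    show "\<bar>\<gamma> a\<bar> \<in> descents n f'"
      unfolding 2 using bij_betwE[OF e] bij_betwE[OF F'.bij_betw_descents] desc_asc[OF a] by blast
  qed
  have rng: "\<bar>\<gamma> a\<bar> \<in> {1..n}" if "a \<in> {1..n}" for a
    using that
  proof (cases rule: F.cases_sign)
    case 1
    then show ?thesis using \<gamma>_asc(2)[of a] by (auto simp: ascents_def)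
  next
    case 2
    then show ?thesis using \<gamma>_desc(3)[of a] by (auto simp: descents_def)
  next
    case 3
    then show ?thesis using \<gamma>_fix(2)[of a] by (auto simp: fixed_def)
  next
    case 4
    then show ?thesis using \<gamma>_neg(2)[of a] by (auto simp: negated_def)
  qed
  have "bij_betw (\<lambda>a. \<bar>\<gamma> a\<bar>) (ascents n f) (ascents n f')"
    using e by (rule bij_betw_cong[THEN iffD1, rotated]) (use \<gamma>_asc in \<open>force simp: ascents_def\<close>)
  moreover have "bij_betw (\<lambda>a. \<bar>\<gamma> a\<bar>) (descents n f) (descents n f')"
    using bij_betw_trans[OF bij_betw_trans[OF F.bij_betw_ascents e] F'.bij_betw_descents]
    by (rule bij_betw_cong[THEN iffD1, rotated]) (simp add: \<gamma>_desc(2))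
  moreover have "bij_betw (\<lambda>a. \<bar>\<gamma> a\<bar>) (fixed n f) (fixed n f')"
    using e1 by (rule bij_betw_cong[THEN iffD1, rotated]) (use \<gamma>_fix in \<open>force simp: fixed_def\<close>)
  moreover have "bij_betw (\<lambda>a. \<bar>\<gamma> a\<bar>) (negated n f) (negated n f')"
    using e2 by (rule bij_betw_cong[THEN iffD1, rotated]) (use \<gamma>_neg in \<open>force simp: negated_def\<close>)
  ultimately have "bij_betw (\<lambda>a. \<bar>\<gamma> a\<bar>)
      (ascents n f \<union> (descents n f \<union> (fixed n f \<union> negated n f)))
      (ascents n f' \<union> (descents n f' \<union> (fixed n f' \<union> negated n f')))"
    by (intro bij_betw_combine) (auto simp: ascents_def descents_def fixed_def negated_def)
  then have inj: "inj_on (\<lambda>a. \<bar>\<gamma> a\<bar>) {1..n}"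
    by (rule inj_on_subset[OF bij_betw_imp_inj_on]) (auto elim: F.cases_sign)
  define g where "g a = (if \<bar>a\<bar> \<le> n then sgn a * \<gamma> \<bar>a\<bar> else a)" for a
  have g_odd: "g (- a) = - g a" for a by (simp add: g_def)
  have pos: "g (f a) = f' (g a)" if a: "a \<in> {1..n}" for a
  proof -
    have ga: "g a = \<gamma> a" using a by (simp add: g_def)
    have gf: "g (f a) = sgn (f a) * \<gamma> \<bar>f a\<bar>" using F.range[OF a] by (simp add: g_def)
    have sgn2: "sgn (f a) * (sgn (f a) * b) = b" for b
      using F.range[OF a] by (auto simp: sgn_if)
    show ?thesis using a
    proof (cases rule: F.cases_sign)
      case 1
      have "\<bar>f a\<bar> \<in> descents n f" using bij_betwE[OF F.bij_betw_descents] 1 by blast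
      then have "\<gamma> \<bar>f a\<bar> = sgn (f \<bar>f a\<bar>) * f' (e \<bar>f \<bar>f a\<bar>\<bar>)" by (rule \<gamma>_desc)
      \<comment> \<open>As \<open>a\<close> is positive, \<open>f \<bar>f a\<bar>\<close> has the
        same sign as \<open>f a\<close>.\<close>
      also have "\<dots> = sgn (f a) * f' (e a)"
        using a by (simp add: F.f_abs_f F.abs_invol sgn_mult) (simp add: abs_mult abs_sgn_eq)
      finally show ?thesis using gf ga \<gamma>_asc[OF 1] sgn2 by simp
    next
      case 2
      have "f' (g a) = sgn (f a) * f' (f' (e \<bar>f a\<bar>))"
        unfolding ga \<gamma>_desc(1)[OF 2] by (rule odd_sgn_mult) (rule F'.odd)
      then show ?thesis using gf \<gamma>_asc(1)[OF desc_asc[OF 2]] by (simp add: F'.invol)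
    next
      case 3
      then have "f a = a" "f' (\<gamma> a) = \<gamma> a" using \<gamma>_fix(2)[OF 3] by (auto simp: fixed_def)
      then show ?thesis using ga by simp
    next
      case 4
      then have "f a = - a" "f' (\<gamma> a) = - \<gamma> a" using \<gamma>_neg(2)[OF 4] by (auto simp: negated_def)
      then show ?thesis using ga g_odd by simp
    qed
  qed
  have zero: "g (f 0) = f' (g 0)"
    using F.odd[of 0] F'.odd[of 0] by (simp add: g_def)
  have "g (f a) = f' (g a)" if "\<bar>a\<bar> \<le> n" for a
  proof (cases a "0 :: int" rule: linorder_cases)
    case less
    then have "g (f (- a)) = f' (g (- a))" using that by (intro pos) auto
    then show ?thesis by (simp add: F.odd F'.odd g_odd)
  qed (use that pos zero in auto)
  moreover have "bij g" unfolding g_def using rng inj by (rule odd_extension_bij)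
  ultimately show thesis using that[of g] g_odd by (simp add: g_def)
qed

section \<open>The elements \<open>c\<^sub>k\<^sub>,\<^sub>l\<close> as signed permutations\<close>

text \<open>The product of the commuting generators at nodes 1, 3, .., 2k-1; the terms
  \<open>sgn a\<close> make the formula odd.\<close>

definition swap_pairs :: "nat \<Rightarrow> int \<Rightarrow> int" where
  "swap_pairs k a = (if \<bar>a\<bar> \<le> 2 * int k then (if odd a then a + sgn a else a - sgn a) else a)"

text \<open>The longest element of type D_(l+1) on the last l+1 coordinates: -1 on all of them is
  even only for odd \<open>l\<close>, so for even \<open>l\<close> coordinate n+1 stays
  fixed.\<close>

definition negate_tail :: "nat \<Rightarrow> nat \<Rightarrow> int \<Rightarrow> int" where
  "negate_tail n l a =
    (if int n - int l < \<bar>a\<bar> \<and> \<bar>a\<bar> \<le> int n \<or> \<bar>a\<bar> = int n + 1 \<and> odd l then - a else a)"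

lemma swap_pairs_minus: "swap_pairs k (- a) = - swap_pairs k a"
  by (simp add: swap_pairs_def)

lemma negate_tail_minus: "negate_tail n l (- a) = - negate_tail n l a"
  by (simp add: negate_tail_def)

lemma abs_negate_tail: "\<bar>negate_tail n l a\<bar> = \<bar>a\<bar>"
  by (simp add: negate_tail_def)

lemma swap_pairs_large: "2 * int k < \<bar>a\<bar> \<Longrightarrow> swap_pairs k a = a"
  by (simp add: swap_pairs_def)

lemma negate_tail_small: "\<bar>a\<bar> \<le> int n - int l \<Longrightarrow> negate_tail n l a = a"
  by (auto simp: negate_tail_def)

lemma swap_pairs_pos:
  assumes "1 \<le> a" "a \<le> 2 * int k"
  shows "swap_pairs k a = (if odd a then a + 1 else a - 1)"
  using assms by (simp add: swap_pairs_def)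

lemma swap_pairs_range:
  assumes "1 \<le> a" "a \<le> 2 * int k"
  shows "1 \<le> swap_pairs k a \<and> swap_pairs k a \<le> 2 * int k"
  using assms by (simp add: swap_pairs_pos) presburger

lemma swap_pairs_swap_pairs: "swap_pairs k (swap_pairs k a) = a"
proof -
  have pos: "swap_pairs k (swap_pairs k b) = b" if "1 \<le> b" for b
  proof (cases "b \<le> 2 * int k")
    case True
    then show ?thesis using swap_pairs_range[OF that True] that by (auto simp: swap_pairs_pos)
  next
    case False
    then show ?thesis using that by (simp add: swap_pairs_large)
  qed
  show ?thesis
  proof (cases a "0 :: int" rule: linorder_cases)
    case less
    then show ?thesis using pos[of "- a"] by (simp add: swap_pairs_minus)
  next
    case equal
    then show ?thesis by (simp add: swap_pairs_def)
  next
    case greater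
    then show ?thesis using pos[of a] by simp
  qed
qed

lemma abs_swap_pairs_le: "\<bar>a\<bar> \<le> 2 * int k \<Longrightarrow> \<bar>swap_pairs k a\<bar> \<le> 2 * int k"
  using swap_pairs_range[of a k] swap_pairs_range[of "- a" k] swap_pairs_minus[of k a]
  by (cases a "0 :: int" rule: linorder_cases) (auto simp: swap_pairs_def)

text \<open>The \<open>l\<close> coordinates up to \<open>n\<close> and the coordinate n+1
  contribute the same sign (-1)^l.\<close>

lemma D_perm_negate_tail:
  assumes "1 \<le> l" "l \<le> n"
  shows "D_perm (n + 1 - l) (n + 1) (negate_tail n l)"
proof -
  have "bij (negate_tail n l)"
    by (rule involuntory_imp_bij) (auto simp: negate_tail_def)
  moreover have "(\<Prod>a\<in>{1..int (n + 1)}. sgn (negate_tail n l a)) = 1"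
  proof -
    have "{1..int (n + 1)} = insert (int n + 1) {1..int n}" by auto
    then have "(\<Prod>a\<in>{1..int (n + 1)}. sgn (negate_tail n l a)) =
        sgn (negate_tail n l (int n + 1)) * (\<Prod>a\<in>{1..int n}. sgn (negate_tail n l a))"
      by simp
    also have "(\<Prod>a\<in>{1..int n}. sgn (negate_tail n l a)) =
        (\<Prod>a\<in>{int n - int l + 1..int n}. sgn (negate_tail n l a))"
      using assms by (intro prod.mono_neutral_right) (auto simp: negate_tail_def)
    also have "\<dots> = (\<Prod>a\<in>{int n - int l + 1..int n}. - 1)"
      using assms by (intro prod.cong) (auto simp: negate_tail_def)
    also have "\<dots> = (- 1) ^ l" by simp
    also have "sgn (negate_tail n l (int n + 1)) = (- 1) ^ l"
      by (simp add: negate_tail_def)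
    finally show ?thesis by (simp flip: power_mult_distrib)
  qed
  ultimately show ?thesis
    using assms unfolding D_perm_def by (auto simp: negate_tail_minus) (auto simp: negate_tail_def)
qed

lemma D_act_swap_pairs:
  assumes "2 * (k + 1) < r"
  shows "swap_pairs k (D_act r (2 * k + 1) a) = swap_pairs (k + 1) a"
proof -
  have act: "D_act r (2 * k + 1) = reflect (2 * int k + 1) (- 2 * int k - 2)"
  proof -
    have "D_fst r (2 * k + 1) = 2 * int k + 1" "D_snd r (2 * k + 1) = - 2 * int k - 2"
      using assms by (simp_all add: D_fst_def D_snd_def)
    then show ?thesis by (simp only: D_act_def)
  qed
  consider "\<bar>a\<bar> \<le> 2 * int k" | "\<bar>a\<bar> = 2 * int k + 1" | "\<bar>a\<bar> = 2 * int k + 2"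
    | "2 * int k + 2 < \<bar>a\<bar>" by linarith
  then show ?thesis
  proof cases
    case 1
    then show ?thesis unfolding act by (simp add: reflect_other swap_pairs_def)
  next
    case 2
    then have "a = 2 * int k + 1 \<or> a = - 2 * int k - 1" by auto
    then show ?thesis unfolding act by (auto simp: reflect_def swap_pairs_def)
  next
    case 3
    then have "a = 2 * int k + 2 \<or> a = - 2 * int k - 2" by auto
    then show ?thesis unfolding act by (auto simp: reflect_def swap_pairs_def)
  next
    case 4
    then show ?thesis unfolding act by (simp add: reflect_other swap_pairs_large)
  qed
qed

lemma foldr_swap_pairs:
  "2 * k < r \<Longrightarrow> foldr (D_act r) (map (\<lambda>i. 2 * i - 1) [1..<k + 1]) a = swap_pairs k a"
proof (induction k arbitrary: a)
  case 0
  then show ?case by (simp add: swap_pairs_def)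
next
  case (Suc k)
  have "[1..<Suc k + 1] = [1..<k + 1] @ [k + 1]" by simp
  then have "foldr (D_act r) (map (\<lambda>i. 2 * i - 1) [1..<Suc k + 1]) a =
      foldr (D_act r) (map (\<lambda>i. 2 * i - 1) [1..<k + 1]) (D_act r (2 * k + 1) a)"
    by (simp del: upt_Suc)
  also have "\<dots> = swap_pairs k (D_act r (2 * k + 1) a)" using Suc by simp
  also have "\<dots> = swap_pairs (Suc k) a" using D_act_swap_pairs[of k r a] Suc.prems by simp
  finally show ?case .
qed

text \<open>The word for the pairs is explicit, whereas a word for the tail is only known to exist,
  by sorting within the nodes of \<open>J_set n l\<close>.\<close>

lemma I_set_word:
  assumes n: "4 \<le> n" and kl: "(k, l) \<in> KL_indices n"
  obtains u where "u \<in> lists (I_set n k l)"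
    "\<And>a. foldr (D_act (n + 1)) u a = swap_pairs k (negate_tail n l a)"
proof -
  have "\<exists>v\<in>lists (J_set n l). foldr (D_act (n + 1)) v = negate_tail n l"
  proof (cases "l = 0")
    case True
    then show ?thesis by (intro bexI[of _ "[]"]) (auto simp: negate_tail_def fun_eq_iff)
  next
    case False
    then have l: "1 \<le> l" "l \<le> n" using kl by (auto simp: KL_indices_def)
    obtain v where "v \<in> lists {n + 1 - l..n + 1}" "foldr (D_act (n + 1)) v = negate_tail n l"
      by (rule D_perm_word[OF _ _ _ D_perm_negate_tail[OF l]]) (use n l in auto)
    then show ?thesis using False by (auto simp: J_set_def)
  qed
  then obtain v where v: "v \<in> lists (J_set n l)" "foldr (D_act (n + 1)) v = negate_tail n l" by blast
  let ?u = "map (\<lambda>i. 2 * i - 1) [1..<k + 1]"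
  have "2 * i - 1 \<in> I_set n k l" if "1 \<le> i" "i \<le> k" for i
    using that unfolding I_set_def by blast
  then have "?u \<in> lists (I_set n k l)" by (auto simp del: upt_Suc)
  moreover have "v \<in> lists (I_set n k l)" using v by (auto simp: I_set_def)
  moreover have "2 * k < n + 1" using kl by (auto simp: KL_indices_def)
  ultimately show thesis
    using that[of "?u @ v"] v foldr_swap_pairs[of k "n + 1"] by (simp del: upt_Suc)
qed

lemma I_set_subset:
  assumes "(k, l) \<in> KL_indices n"
  shows "I_set n k l \<subseteq> D_nodes (n + 1)"
proof -
  have "2 * k + l \<le> n" using assms by (auto simp: KL_indices_def)
  then show ?thesis by (auto simp: I_set_def J_set_def D_nodes_def)
qed

text \<open>The roots e_(2i-1) - e_(2i) and their negatives: k orthogonal systems of type A_1. With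
  \<open>tail_roots\<close>, of type D_(l+1), they form the subsystem \<open>P\<close> demanded by
  \<open>longest_element_eq\<close>.\<close>

definition pair_roots :: "nat \<Rightarrow> int set set" where
  "pair_roots k = {{e * (2 * i - 1), - (e * (2 * i))} | e i. e \<in> {1, - 1} \<and> 1 \<le> i \<and> i \<le> int k}"

definition tail_roots :: "nat \<Rightarrow> nat \<Rightarrow> int set set" where
  "tail_roots n l = (if l = 0 then {} else {\<beta> \<in> D_roots (n + 1). \<forall>a\<in>\<beta>. int n - int l < \<bar>a\<bar>})"

lemma D_perm_of_longest_I_set:
  assumes n: "4 \<le> n" and kl: "(k, l) \<in> KL_indices n"
  shows "longest_D (n + 1) (I_set n k l) \<in> carrier (W_D (n + 1))"
    and "D_perm_of (n + 1) (longest_D (n + 1) (I_set n k l)) a = swap_pairs k (negate_tail n l a)"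
proof -
  define r where "r = n + 1"
  have r: "4 \<le> r" and rn: "int r = int n + 1" using n by (simp_all add: r_def)
  have kln: "2 * k + l \<le> n" using kl by (auto simp: KL_indices_def)
  obtain u where u: "u \<in> lists (I_set n k l)"
    "\<And>a. foldr (D_act r) u a = swap_pairs k (negate_tail n l a)"
    using I_set_word[OF n kl] unfolding r_def by blast
  let ?P = "pair_roots k \<union> tail_roots n l"
  have I: "I_set n k l \<subseteq> D_nodes r" using I_set_subset[OF kl] by (simp add: r_def)
  have node: "(\<exists>i. 1 \<le> i \<and> i \<le> int k \<and> int s = 2 * i - 1) \<or> l \<noteq> 0 \<and> int n - int l < int s \<and> s \<le> r"
    if "s \<in> I_set n k l" for s
  proof -
    have "(\<exists>i. 1 \<le> i \<and> i \<le> k \<and> s = 2 * i - 1) \<or> l \<noteq> 0 \<and> n + 1 - l \<le> s \<and> s \<le> r"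
      using that by (auto simp: I_set_def J_set_def r_def split: if_splits)
    then show ?thesis
    proof
      assume "\<exists>i. 1 \<le> i \<and> i \<le> k \<and> s = 2 * i - 1"
      then obtain i where "1 \<le> i" "i \<le> k" "s = 2 * i - 1" by blast
      then show ?thesis by (intro disjI1 exI[of _ "int i"]) (simp add: of_nat_diff)
    qed (use kln in auto)
  qed
  have fs_pair: "D_fst r s = 2 * i - 1" "D_snd r s = - (2 * i)"
    if "int s = 2 * i - 1" "i \<le> int k" for s i
    using that kln rn by (auto simp: D_fst_def D_snd_def)
  have fs_tail: "int n - int l < \<bar>D_fst r s\<bar>" "int n - int l < \<bar>D_snd r s\<bar>"
    if "int n - int l < int s" "l \<noteq> 0" for s
    using that kln rn by (auto simp: D_fst_def D_snd_def)
  have P_roots: "?P \<subseteq> D_roots r"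
  proof
    fix \<beta> assume "\<beta> \<in> ?P"
    then consider "\<beta> \<in> pair_roots k" | "\<beta> \<in> tail_roots n l" by blast
    then show "\<beta> \<in> D_roots r"
    proof cases
      case 1
      then obtain e i where "\<beta> = {e * (2 * i - 1), - (e * (2 * i))}" "e \<in> {1, - 1}" "1 \<le> i" "i \<le> int k"
        by (auto simp: pair_roots_def)
      then show ?thesis unfolding D_roots_def using kln rn
        by (intro CollectI exI[of _ "e * (2 * i - 1)"] exI[of _ "- (e * (2 * i))"]) auto
    next
      case 2
      then show ?thesis by (simp add: tail_roots_def r_def split: if_splits)
    qed
  qed
  interpret simply_laced_action "D_nodes r" "D_matrix r" "D_roots r"
    "(`) uminus" "\<lambda>t. (`) (D_act r t)" "D_root r" "D_ht r"
    by (rule D_simply_laced_action[OF r])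
  have root_P: "D_root r s \<in> ?P" if s: "s \<in> I_set n k l" for s
    using node[OF s]
  proof
    assume "\<exists>i. 1 \<le> i \<and> i \<le> int k \<and> int s = 2 * i - 1"
    then obtain i where i: "1 \<le> i" "i \<le> int k" "int s = 2 * i - 1" by blast
    then have "D_root r s = {1 * (2 * i - 1), - (1 * (2 * i))}" using fs_pair by (simp add: D_root_def)
    then have "D_root r s \<in> pair_roots k" unfolding pair_roots_def using i by blast
    then show ?thesis by simp
  next
    assume "l \<noteq> 0 \<and> int n - int l < int s \<and> s \<le> r"
    then have "D_root r s \<in> tail_roots n l"
      using root_R[of s] I s fs_tail[of s] by (auto simp: tail_roots_def r_def D_root_def)
    then show ?thesis by simp
  qed
  have act_P: "D_act r s ` \<beta> \<in> ?P" if s: "s \<in> I_set n k l" and \<beta>: "\<beta> \<in> ?P" for s \<beta>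
  proof -
    \<comment> \<open>The cases pair a node type with a root type. In the mixed cases the supports
      are disjoint, as 2k <= n-l, and the node acts trivially on the root.\<close>
    consider (pp) i where "\<beta> \<in> pair_roots k" "1 \<le> i" "i \<le> int k" "int s = 2 * i - 1"
      | (pt) "\<beta> \<in> pair_roots k" "l \<noteq> 0" "int n - int l < int s"
      | (tp) i where "\<beta> \<in> tail_roots n l" "1 \<le> i" "i \<le> int k" "int s = 2 * i - 1"
      | (tt) "\<beta> \<in> tail_roots n l" "l \<noteq> 0" "int n - int l < int s"
      using node[OF s] \<beta> by blast
    then show ?thesis
    proof cases
      case pp
      obtain e j where b: "\<beta> = {e * (2 * j - 1), - (e * (2 * j))}" "e \<in> {1, - 1}" "1 \<le> j" "j \<le> int k"
        using pp by (auto simp: pair_roots_def)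
      show ?thesis
      proof (cases "i = j")
        case True
        then have "D_act r s ` \<beta> = {- e * (2 * j - 1), - (- e * (2 * j))}"
          using b fs_pair[OF pp(4,3)] reflect_fst[of "2 * j - 1" "- (2 * j)"]
            reflect_snd[of "2 * j - 1" "- (2 * j)"]
            reflect_minus[of "2 * j - 1" "- (2 * j)" "2 * j - 1"]
            reflect_minus[of "2 * j - 1" "- (2 * j)" "- (2 * j)"]
          by (auto simp: D_act_def)
        moreover have "- e \<in> {1, - 1}" using b by auto
        ultimately have "D_act r s ` \<beta> \<in> pair_roots k" unfolding pair_roots_def using b by blast
        then show ?thesis by simp
      next
        case False
        have "D_act r s a = a" if "a \<in> \<beta>" for a
        proof -
          have "\<bar>a\<bar> = 2 * j - 1 \<or> \<bar>a\<bar> = 2 * j" using that b by auto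
          moreover have "\<bar>2 * i - 1\<bar> = 2 * i - 1" "\<bar>- (2 * i)\<bar> = 2 * i" using pp by auto
          ultimately have "\<bar>a\<bar> \<noteq> \<bar>2 * i - 1\<bar>" "\<bar>a\<bar> \<noteq> \<bar>- (2 * i)\<bar>"
            using False by presburger+
          then show ?thesis unfolding D_act_def fs_pair[OF pp(4,3)] by (rule reflect_other)
        qed
        then show ?thesis using \<beta> by simp
      qed
    next
      case pt
      obtain e j where b: "\<beta> = {e * (2 * j - 1), - (e * (2 * j))}" "e \<in> {1, - 1}" "1 \<le> j" "j \<le> int k"
        using pt by (auto simp: pair_roots_def)
      have "\<bar>a\<bar> \<le> int n - int l" if "a \<in> \<beta>" for a using that b kln by auto
      then have "D_act r s a = a" if "a \<in> \<beta>" for a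
        unfolding D_act_def using fs_tail[OF pt(3,2)] that by (intro reflect_other) force+
      then show ?thesis using \<beta> by simp
    next
      case tp
      have "int n - int l < \<bar>a\<bar>" if "a \<in> \<beta>" for a
        using that tp by (auto simp: tail_roots_def split: if_splits)
      then have "D_act r s a = a" if "a \<in> \<beta>" for a
        unfolding D_act_def fs_pair[OF tp(4,3)] using tp that kln by (intro reflect_other) force+
      then show ?thesis using \<beta> by simp
    next
      case tt
      have "\<beta> \<in> D_roots r" "s \<in> D_nodes r" using P_roots I \<beta> s by blast+
      then have "D_act r s ` \<beta> \<in> D_roots r" by (rule act_R[rotated])
      moreover have "int n - int l < \<bar>D_act r s a\<bar>" if "a \<in> \<beta>" for a
        unfolding D_act_def abs_reflect using fs_tail[OF tt(3,2)] tt(1) that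
        by (auto simp: tail_roots_def split: if_splits)
      ultimately have "D_act r s ` \<beta> \<in> tail_roots n l"
        using tt by (simp add: tail_roots_def r_def)
      then show ?thesis by simp
    qed
  qed
  have negate: "D_ht r (foldr (D_act r) u ` \<beta>) = - D_ht r \<beta>" if \<beta>: "\<beta> \<in> ?P" for \<beta>
  proof -
    consider "\<beta> \<in> pair_roots k" | "\<beta> \<in> tail_roots n l" using \<beta> by blast
    then show ?thesis
    proof cases
      case 1
      then obtain e i where b: "\<beta> = {e * (2 * i - 1), - (e * (2 * i))}" "e \<in> {1, - 1}" "1 \<le> i" "i \<le> int k"
        by (auto simp: pair_roots_def)
      have "foldr (D_act r) u (2 * i - 1) = 2 * i" "foldr (D_act r) u (2 * i) = 2 * i - 1"
        using b kln by (simp_all add: u(2) negate_tail_small swap_pairs_pos)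
      moreover have "foldr (D_act r) u (- a) = - foldr (D_act r) u a" for a
        by (simp add: u(2) swap_pairs_minus negate_tail_minus)
      ultimately have "foldr (D_act r) u ` \<beta> = {e * (2 * i), - (e * (2 * i - 1))}"
        using b by (auto simp del: minus_diff_eq)
      moreover have "e * (2 * i) \<noteq> - (e * (2 * i - 1))" "e * (2 * i - 1) \<noteq> - (e * (2 * i))"
        using b by auto
      ultimately show ?thesis by (simp add: b(1) D_ht_pair coord_ht_minus del: minus_diff_eq)
    next
      case 2
      obtain a b where ab: "\<beta> = {a, b}" "\<bar>a\<bar> \<noteq> \<bar>b\<bar>" "\<bar>a\<bar> \<le> int r" "\<bar>b\<bar> \<le> int r"
        using 2 by (auto simp: tail_roots_def D_roots_def r_def split: if_splits)
      have big: "int n - int l < \<bar>a\<bar>" "int n - int l < \<bar>b\<bar>"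
        using 2 ab by (auto simp: tail_roots_def split: if_splits)
      \<comment> \<open>Coordinate n+1 may be fixed or negated, but its height is 0 either way; the
        other tail coordinates are negated.\<close>
      have abs_u: "\<bar>foldr (D_act r) u c\<bar> = \<bar>c\<bar>" "coord_ht r (foldr (D_act r) u c) = - coord_ht r c"
        if c: "int n - int l < \<bar>c\<bar>" "\<bar>c\<bar> \<le> int r" for c
      proof -
        have uc: "foldr (D_act r) u c = negate_tail n l c"
          unfolding u(2) using c kln by (intro swap_pairs_large) (simp add: abs_negate_tail)
        show "\<bar>foldr (D_act r) u c\<bar> = \<bar>c\<bar>" by (simp add: uc abs_negate_tail)
        show "coord_ht r (foldr (D_act r) u c) = - coord_ht r c"
        proof (cases "\<bar>c\<bar> \<le> int n")
          case True
          then show ?thesis using c by (simp add: uc negate_tail_def coord_ht_minus)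
        next
          case False
          then have "\<bar>c\<bar> = int r" using c rn by simp
          then show ?thesis by (simp add: uc coord_ht_def abs_negate_tail)
        qed
      qed
      have "a \<noteq> b" "foldr (D_act r) u a \<noteq> foldr (D_act r) u b"
        using ab abs_u[of a] abs_u[of b] big by auto
      then show ?thesis using ab abs_u[of a] abs_u[of b] big by (simp add: D_ht_pair)
    qed
  qed
  show "longest_D (n + 1) (I_set n k l) \<in> carrier (W_D (n + 1))"
    "D_perm_of (n + 1) (longest_D (n + 1) (I_set n k l)) a = swap_pairs k (negate_tail n l a)"
    using D_perm_of_longest[OF r I u(1) P_roots root_P act_P negate] u(2) by (simp_all add: r_def)
qed

section \<open>Involutions in the centralizer of \<open>w\<^sub>o\<close>\<close>

text \<open>Absolute values under \<open>g\<close> inject the moved and the negated coordinates of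
  \<open>f\<close> into those of \<open>f'\<close>. An inequality is enough, because conjugacy can
  be reversed.\<close>

lemma card_cycle_types_le:
  fixes f f' g :: "int \<Rightarrow> int"
  assumes f': "\<And>a. f' (- a) = - f' a" and g: "inj g" "\<And>a. g (- a) = - g a"
    and gn: "\<And>a. \<bar>a\<bar> \<le> n \<Longrightarrow> \<bar>g a\<bar> \<le> n" and eq: "\<And>a. f' (g a) = g (f a)"
  shows "card (moved n f) \<le> card (moved n f')" "card (negated n f) \<le> card (negated n f')"
proof -
  note g_abs = odd_inj_abs_eq_iff[OF g]
  have f'_abs: "\<bar>f' \<bar>b\<bar>\<bar> = \<bar>f' b\<bar>" for b by (simp add: abs_if f')
  have in_n: "\<bar>g a\<bar> \<in> {1..n}" if "a \<in> {1..n}" for a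
  proof -
    have "\<bar>g a\<bar> \<noteq> \<bar>g 0\<bar>" using g_abs[of a 0] that by simp
    then show ?thesis using gn[of a] that odd_zero[of g, OF g(2)] by auto
  qed
  have inj: "inj_on (\<lambda>a. \<bar>g a\<bar>) A" if "A \<subseteq> {1..n}" for A
  proof (rule inj_onI)
    fix a b assume ab: "a \<in> A" "b \<in> A" "\<bar>g a\<bar> = \<bar>g b\<bar>"
    then have "1 \<le> a" "1 \<le> b" using that by auto
    moreover have "\<bar>a\<bar> = \<bar>b\<bar>" using ab(3) g_abs by blast
    ultimately show "a = b" by simp
  qed
  have "\<bar>g a\<bar> \<in> moved n f'" if "a \<in> moved n f" for a
    using that in_n[of a] g_abs[of "f a" a] by (auto simp: moved_def f'_abs eq)
  then show "card (moved n f) \<le> card (moved n f')"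
    by (intro card_inj_on_le[OF inj]) (auto simp: moved_def[of n f])
  have "\<bar>g a\<bar> \<in> negated n f'" if "a \<in> negated n f" for a
  proof -
    have "f' (g a) = - g a" using that eq[of a] g(2) by (simp add: negated_def)
    then have "f' \<bar>g a\<bar> = - \<bar>g a\<bar>" using f'[of "g a"] by (simp add: abs_if)
    then show ?thesis using that in_n[of a] by (simp add: negated_def)
  qed
  then show "card (negated n f) \<le> card (negated n f')"
    by (intro card_inj_on_le[OF inj]) (auto simp: negated_def[of n f])
qed

text \<open>Since the product of all signs is 1, the signs on 1..n determine the remaining sign at
  n+1.\<close>

lemma D_perm_determined:
  assumes f: "D_perm 1 (n + 1) f" "\<bar>f (int n + 1)\<bar> = int n + 1"
    and f': "D_perm 1 (n + 1) f'" "\<bar>f' (int n + 1)\<bar> = int n + 1"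
    and eq: "\<And>a. \<bar>a\<bar> \<le> int n \<Longrightarrow> f a = f' a"
  shows "f = f'"
proof -
  have ins: "{1..int (n + 1)} = insert (int n + 1) {1..int n}" by auto
  have "sgn (h (int n + 1)) * (\<Prod>a\<in>{1..int n}. sgn (h a)) = 1" if "D_perm 1 (n + 1) h" for h
    using D_permD(6)[OF that] unfolding ins by simp
  from this[OF f(1)] this[OF f'(1)]
  have "sgn (f (int n + 1)) * (\<Prod>a\<in>{1..int n}. sgn (f' a)) = 1"
    "sgn (f' (int n + 1)) * (\<Prod>a\<in>{1..int n}. sgn (f' a)) = 1"
    using eq by simp_all
  then have "sgn (f (int n + 1)) = sgn (f' (int n + 1))"
    by (metis mult_cancel_right mult_zero_right zero_neq_one)
  then have last: "f (int n + 1) = f' (int n + 1)" using f(2) f'(2) by (metis sgn_mult_abs)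
  show ?thesis
  proof
    fix a
    consider "\<bar>a\<bar> \<le> int n" | "a = int n + 1" | "a = - (int n + 1)" | "int (n + 1) < \<bar>a\<bar>"
      by force
    then show "f a = f' a"
    proof cases
      case 1
      then show ?thesis by (rule eq)
    next
      case 2
      then show ?thesis using last by simp
    next
      case 3
      then show ?thesis using last D_permD(3)[OF f(1)] D_permD(3)[OF f'(1)] by metis
    next
      case 4
      then show ?thesis using D_permD(5)[OF f(1)] D_permD(5)[OF f'(1)] by metis
    qed
  qed
qed

section \<open>The centralizer, its involutions and their classes\<close>

locale D_odd =
  fixes n r :: nat
  assumes n4: "4 \<le> n" and even_n: "even n" and r_eq: "r = n + 1"
begin

abbreviation "G \<equiv> W_D r"
abbreviation "P \<equiv> D_perm_of r"
abbreviation "w\<^sub>o \<equiv> longest_D r (D_nodes r)"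
abbreviation "C \<equiv> centralizer_of G w\<^sub>o"
abbreviation "c k l \<equiv> longest_D r (I_set n k l)"

sublocale group G by (rule group_W_D)

lemma r4: "4 \<le> r"
  using n4 by (simp add: r_eq)

lemma int_r: "int r = int n + 1"
  by (simp add: r_eq)

lemma KL_indices_iff: "(k, l) \<in> KL_indices n \<longleftrightarrow> 2 * k + l \<le> n"
  by (auto simp: KL_indices_def)

lemma c_carrier: "(k, l) \<in> KL_indices n \<Longrightarrow> c k l \<in> carrier G"
  by (rule D_perm_of_longest_I_set(1)[OF n4, folded r_eq])

lemma P_c: "(k, l) \<in> KL_indices n \<Longrightarrow> P (c k l) a = swap_pairs k (negate_tail n l a)"
  by (rule D_perm_of_longest_I_set(2)[OF n4, folded r_eq])

text \<open>Treats the longest element as the case \<open>k = 0\<close>, \<open>l = n\<close>, so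
  its signed permutation is an instance of \<open>P_c\<close>.\<close>

lemma w\<^sub>o_eq: "w\<^sub>o = c 0 n"
proof -
  have "I_set n 0 n = D_nodes r" using n4 by (auto simp: r_eq I_set_def J_set_def D_nodes_def)
  then show ?thesis by simp
qed

lemma w\<^sub>o_carrier: "w\<^sub>o \<in> carrier G"
  using c_carrier[of 0 n] by (simp add: w\<^sub>o_eq KL_indices_iff)

lemma P_w\<^sub>o: "P w\<^sub>o a = (if \<bar>a\<bar> \<le> int n then - a else a)"
proof -
  have "P w\<^sub>o a = swap_pairs 0 (negate_tail n n a)"
    unfolding w\<^sub>o_eq by (rule P_c) (simp add: KL_indices_iff)
  \<comment> \<open>Evenness of \<open>n\<close> is what leaves coordinate n+1 fixed.\<close>
  then show ?thesis using even_n by (auto simp: swap_pairs_def negate_tail_def)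
qed

lemma P_mult: "x \<in> carrier G \<Longrightarrow> y \<in> carrier G \<Longrightarrow> P (x \<otimes>\<^bsub>G\<^esub> y) a = P x (P y a)"
  using D_perm_of_mult[OF r4] by simp

lemma P_eqI: "x \<in> carrier G \<Longrightarrow> y \<in> carrier G \<Longrightarrow> (\<And>a. P x a = P y a) \<Longrightarrow> x = y"
  using D_perm_of_inj[OF r4] by blast

lemma P_D_perm: "x \<in> carrier G \<Longrightarrow> D_perm 1 r (P x)"
  by (rule D_perm_D_perm_of[OF r4])

lemma P_minus: "x \<in> carrier G \<Longrightarrow> P x (- a) = - P x a"
  using P_D_perm D_permD(3) by blast

lemma P_inj: "x \<in> carrier G \<Longrightarrow> inj (P x)"
  using P_D_perm D_permD(2) by blast

lemma P_abs_eq_iff: "x \<in> carrier G \<Longrightarrow> \<bar>P x a\<bar> = \<bar>P x b\<bar> \<longleftrightarrow> \<bar>a\<bar> = \<bar>b\<bar>"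
  using odd_inj_abs_eq_iff[OF P_inj P_minus] by blast

lemma P_le: "x \<in> carrier G \<Longrightarrow> \<bar>a\<bar> \<le> int n + 1 \<Longrightarrow> \<bar>P x a\<bar> \<le> int n + 1"
  using odd_inj_abs_le[of "P x" "int r" a] P_inj D_permD(5)[OF P_D_perm] by (simp add: int_r)

lemma abs_P_le_iff:
  assumes x: "x \<in> carrier G" "\<bar>P x (int n + 1)\<bar> = int n + 1" and a: "\<bar>a\<bar> \<le> int n"
  shows "\<bar>P x a\<bar> \<le> int n"
proof -
  have "\<bar>P x a\<bar> \<noteq> \<bar>P x (int n + 1)\<bar>" using P_abs_eq_iff[OF x(1), of a "int n + 1"] a by auto
  then show ?thesis using P_le[OF x(1), of a] x(2) a by linarith
qed

text \<open>Among the integers of absolute value at most r, \<open>w\<^sub>o\<close> fixes only 0, r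
  and -r, and a commuting element permutes the fixed points. Conversely, an element preserving r up
  to sign also preserves the coordinates up to \<open>n\<close>, on which \<open>w\<^sub>o\<close>
  is -1.\<close>

lemma C_iff: "x \<in> C \<longleftrightarrow> x \<in> carrier G \<and> \<bar>P x (int n + 1)\<bar> = int n + 1"
proof (cases "x \<in> carrier G")
  case x: True
  have "x \<otimes>\<^bsub>G\<^esub> w\<^sub>o = w\<^sub>o \<otimes>\<^bsub>G\<^esub> x \<longleftrightarrow> \<bar>P x (int n + 1)\<bar> = int n + 1"
  proof
    assume "x \<otimes>\<^bsub>G\<^esub> w\<^sub>o = w\<^sub>o \<otimes>\<^bsub>G\<^esub> x"
    then have "P x (P w\<^sub>o (int n + 1)) = P w\<^sub>o (P x (int n + 1))"
      using P_mult x w\<^sub>o_carrier by metis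
    then have *: "P x (int n + 1) = P w\<^sub>o (P x (int n + 1))" by (simp add: P_w\<^sub>o[of "int n + 1"])
    have "P x (int n + 1) \<noteq> 0"
      using P_abs_eq_iff[OF x, of "int n + 1" 0] odd_zero[of "P x"] P_minus[OF x] by auto
    then have "\<not> \<bar>P x (int n + 1)\<bar> \<le> int n" using * by (auto simp: P_w\<^sub>o split: if_splits)
    then show "\<bar>P x (int n + 1)\<bar> = int n + 1" using P_le[OF x, of "int n + 1"] by simp
  next
    assume last: "\<bar>P x (int n + 1)\<bar> = int n + 1"
    show "x \<otimes>\<^bsub>G\<^esub> w\<^sub>o = w\<^sub>o \<otimes>\<^bsub>G\<^esub> x"
    proof (rule P_eqI)
      fix a
      have "\<bar>P x a\<bar> \<le> int n \<longleftrightarrow> \<bar>a\<bar> \<le> int n"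
      proof (cases "\<bar>a\<bar> \<le> int n")
        case True
        then show ?thesis using abs_P_le_iff[OF x last] by simp
      next
        case False
        consider "\<bar>a\<bar> = int n + 1" | "int r < \<bar>a\<bar>" using False int_r by force
        then show ?thesis
        proof cases
          case 1
          then have "\<bar>P x a\<bar> = int n + 1" using P_abs_eq_iff[OF x, of a "int n + 1"] last by simp
          then show ?thesis using 1 by simp
        next
          case 2
          then show ?thesis using D_permD(5)[OF P_D_perm[OF x], of a] int_r by simp
        qed
      qed
      then show "P (x \<otimes>\<^bsub>G\<^esub> w\<^sub>o) a = P (w\<^sub>o \<otimes>\<^bsub>G\<^esub> x) a"
        by (simp add: P_mult x w\<^sub>o_carrier P_w\<^sub>o P_minus)
    qed (use x w\<^sub>o_carrier in auto)
  qed
  then show ?thesis using x by (simp add: centralizer_of_def)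
qed (simp add: centralizer_of_def)

lemma C_carrier: "x \<in> C \<Longrightarrow> x \<in> carrier G"
  by (simp add: centralizer_of_def)

lemma C_mult: "x \<in> C \<Longrightarrow> y \<in> C \<Longrightarrow> x \<otimes>\<^bsub>G\<^esub> y \<in> C"
  unfolding C_iff using P_abs_eq_iff[of x "P y (int n + 1)" "int n + 1"] by (auto simp: P_mult)

lemma C_inv:
  assumes "x \<in> C"
  shows "inv\<^bsub>G\<^esub> x \<in> C"
proof -
  have x: "x \<in> carrier G" "\<bar>P x (int n + 1)\<bar> = int n + 1" using assms by (simp_all add: C_iff)
  have "P x (P (inv\<^bsub>G\<^esub> x) (int n + 1)) = P (x \<otimes>\<^bsub>G\<^esub> inv\<^bsub>G\<^esub> x) (int n + 1)"
    using x(1) by (intro P_mult[symmetric]) auto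
  also have "\<dots> = int n + 1" using x(1) D_perm_of_one[OF r4] by simp
  finally have "P x (P (inv\<^bsub>G\<^esub> x) (int n + 1)) = int n + 1" .
  then have "\<bar>P (inv\<^bsub>G\<^esub> x) (int n + 1)\<bar> = int n + 1"
    using x P_abs_eq_iff[OF x(1), of "P (inv\<^bsub>G\<^esub> x) (int n + 1)" "int n + 1"] by simp
  then show ?thesis using x by (simp add: C_iff)
qed

lemma involution_P:
  assumes "x \<in> C" "is_involution G x"
  shows "odd_involution (int n) (P x)"
proof
  have x: "x \<in> carrier G" "\<bar>P x (int n + 1)\<bar> = int n + 1" using assms by (simp_all add: C_iff)
  show "P x (- a) = - P x a" for a by (rule P_minus[OF x(1)])
  show "P x (P x a) = a" for a
    using assms(2) P_mult[OF x(1,1), of a] D_perm_of_one[OF r4] by (simp add: is_involution_def)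
  show "\<bar>P x a\<bar> \<in> {1..int n}" if "a \<in> {1..int n}" for a
  proof -
    have "P x a \<noteq> 0" using P_abs_eq_iff[OF x(1), of a 0] odd_zero[of "P x"] P_minus[OF x(1)] that by auto
    then show ?thesis using abs_P_le_iff[OF x, of a] that by auto
  qed
qed

lemma is_involution_iff: "is_involution G x \<longleftrightarrow> x \<in> carrier G \<and> (\<forall>a. P x (P x a) = a)"
proof
  assume "x \<in> carrier G \<and> (\<forall>a. P x (P x a) = a)"
  then show "is_involution G x"
    using P_eqI[of "x \<otimes>\<^bsub>G\<^esub> x" "\<one>\<^bsub>G\<^esub>"] D_perm_of_one[OF r4] by (simp add: P_mult is_involution_def)
next
  assume "is_involution G x"
  then show "x \<in> carrier G \<and> (\<forall>a. P x (P x a) = a)"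
    using P_mult[of x x] D_perm_of_one[OF r4] by (simp add: is_involution_def)
qed

lemma card_cycle_types_conj_le:
  assumes x: "x \<in> C" and g: "g \<in> C" and y: "y = g \<otimes>\<^bsub>G\<^esub> x \<otimes>\<^bsub>G\<^esub> inv\<^bsub>G\<^esub> g"
  shows "card (moved (int n) (P x)) \<le> card (moved (int n) (P y))"
    "card (negated (int n) (P x)) \<le> card (negated (int n) (P y))"
proof -
  have carr: "x \<in> carrier G" "g \<in> carrier G" using x g C_carrier by blast+
  have "y \<in> carrier G" "y \<otimes>\<^bsub>G\<^esub> g = g \<otimes>\<^bsub>G\<^esub> x" using carr by (simp_all add: y m_assoc)
  then have eq: "P y (P g a) = P g (P x a)" for a using carr P_mult by metis
  have gn: "\<bar>P g a\<bar> \<le> int n" if "\<bar>a\<bar> \<le> int n" for a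
    using abs_P_le_iff[of g a] g that by (simp add: C_iff)
  show "card (moved (int n) (P x)) \<le> card (moved (int n) (P y))"
    "card (negated (int n) (P x)) \<le> card (negated (int n) (P y))"
    using card_cycle_types_le[of "P y" "P g" "int n" "P x"] eq gn P_minus P_inj carr \<open>y \<in> carrier G\<close>
    by blast+
qed

lemma conjugate_imp_card_eq:
  assumes "conjugate_in G C x y"
  shows "card (moved (int n) (P x)) = card (moved (int n) (P y))"
    "card (negated (int n) (P x)) = card (negated (int n) (P y))"
proof -
  obtain g where g: "x \<in> C" "y \<in> C" "g \<in> C" "y = g \<otimes>\<^bsub>G\<^esub> x \<otimes>\<^bsub>G\<^esub> inv\<^bsub>G\<^esub> g"
    using assms by (auto simp: conjugate_in_def)
  have carr: "x \<in> carrier G" "g \<in> carrier G" using g C_carrier by blast+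
  have "x = inv\<^bsub>G\<^esub> g \<otimes>\<^bsub>G\<^esub> y \<otimes>\<^bsub>G\<^esub> inv\<^bsub>G\<^esub> (inv\<^bsub>G\<^esub> g)"
    using carr by (simp add: g(4) m_assoc inv_solve_left)
  then show "card (moved (int n) (P x)) = card (moved (int n) (P y))"
    "card (negated (int n) (P x)) = card (negated (int n) (P y))"
    using card_cycle_types_conj_le[OF g(1,3,4)] card_cycle_types_conj_le[OF g(2) C_inv[OF g(3)]]
    by (metis order_antisym)+
qed

text \<open>The conjugator on 1..n comes from \<open>odd_involution_conjugator\<close>. It can
  violate parity, and the free sign at coordinate n+1 repairs this without leaving the
  centralizer.\<close>

lemma conjugate_if_card_eq:
  assumes x: "x \<in> C" "is_involution G x" and y: "y \<in> C" "is_involution G y"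
    and m: "card (moved (int n) (P x)) = card (moved (int n) (P y))"
    and q: "card (negated (int n) (P x)) = card (negated (int n) (P y))"
  shows "conjugate_in G C x y"
proof -
  obtain g where g: "bij g" "\<And>a. g (- a) = - g a" "\<And>a. int n < \<bar>a\<bar> \<Longrightarrow> g a = a"
    "\<And>a. \<bar>a\<bar> \<le> int n \<Longrightarrow> g (P x a) = P y (g a)"
    using odd_involution_conjugator[OF involution_P[OF x] involution_P[OF y] m q] by metis
  have g_nz: "g a \<noteq> 0" if "a \<noteq> 0" for a
    using that g(1) odd_zero[of g, OF g(2)] by (metis bij_is_inj injD)
  define e where "e = (\<Prod>a\<in>{1..int n}. sgn (g a))"
  have "e * e = (\<Prod>a\<in>{1..int n}. sgn (g a) * sgn (g a))" by (simp only: e_def prod.distrib)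
  also have "\<dots> = 1" using g_nz by (intro prod.neutral) (auto simp: sgn_if)
  finally have ee: "e * e = 1" .
  then have e1: "e = 1 \<or> e = - 1" by (metis zmult_eq_1_iff)
  \<comment> \<open>As \<open>e\<close> is -1 exactly when \<open>g\<close> changes an odd number of
    signs, scaling coordinate n+1 by \<open>e\<close> makes the map even and changes nothing up to
    \<open>n\<close>.\<close>
  define h where "h a = g (if \<bar>a\<bar> = int n + 1 then e * a else a)" for a
  have h_last: "h (int n + 1) = e * (int n + 1)" using e1 by (auto simp: h_def g(3))
  have h_le: "h a = g a" if "\<bar>a\<bar> \<le> int n" for a using that by (simp add: h_def)
  have "D_perm 1 r h"
  proof -
    have "bij (\<lambda>a. if \<bar>a\<bar> = int n + 1 then e * a else a)"
      by (rule involuntory_imp_bij) (use e1 in auto)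
    then have "bij (g \<circ> (\<lambda>a. if \<bar>a\<bar> = int n + 1 then e * a else a))" using g(1) by (intro bij_comp)
    then have "bij h" by (simp add: h_def[abs_def] comp_def)
    moreover have "h (- a) = - h a" for a using g(2) by (simp add: h_def)
    moreover have "h a = a" if "\<bar>a\<bar> < int 1 \<or> int r < \<bar>a\<bar>" for a
      using that int_r g(3)[of a] odd_zero[of g, OF g(2)] by (auto simp: h_def)
    moreover have "(\<Prod>a\<in>{1..int r}. sgn (h a)) = 1"
    proof -
      have "{1..int r} = insert (int n + 1) {1..int n}" using int_r by auto
      then have "(\<Prod>a\<in>{1..int r}. sgn (h a)) = sgn (h (int n + 1)) * (\<Prod>a\<in>{1..int n}. sgn (h a))"
        by simp
      also have "(\<Prod>a\<in>{1..int n}. sgn (h a)) = e" unfolding e_def by (intro prod.cong) (auto simp: h_le)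
      also have "sgn (h (int n + 1)) = e" using e1 by (auto simp: h_last)
      finally show ?thesis using ee by simp
    qed
    ultimately show ?thesis unfolding D_perm_def by blast
  qed
  then obtain b where b: "b \<in> carrier G" "P b = h" using D_perm_of_surj[OF r4] by blast
  have "\<bar>P b (int n + 1)\<bar> = int n + 1" using e1 by (auto simp: b h_last)
  then have bC: "b \<in> C" using b by (simp add: C_iff)
  define z where "z = b \<otimes>\<^bsub>G\<^esub> x \<otimes>\<^bsub>G\<^esub> inv\<^bsub>G\<^esub> b"
  have carr: "x \<in> carrier G" "y \<in> carrier G" using x y C_carrier by blast+
  have zC: "z \<in> C" using bC x by (simp add: z_def C_mult C_inv)
  then have z: "z \<in> carrier G" by (rule C_carrier)
  have "z \<otimes>\<^bsub>G\<^esub> b = b \<otimes>\<^bsub>G\<^esub> x" using b carr by (simp add: z_def m_assoc)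
  then have zb: "P z (h a) = h (P x a)" for a using P_mult b z carr by metis
  \<comment> \<open>The relation for \<open>g\<close> covers only coordinates up to
    \<open>n\<close>; membership in the centralizer and parity settle coordinate n+1.\<close>
  have "P z = P y"
  proof (rule D_perm_determined[of n, folded r_eq])
    show "D_perm 1 r (P z)" "D_perm 1 r (P y)" using P_D_perm z carr by blast+
    show "\<bar>P z (int n + 1)\<bar> = int n + 1" "\<bar>P y (int n + 1)\<bar> = int n + 1"
      using zC y by (simp_all add: C_iff)
    fix a assume a: "\<bar>a\<bar> \<le> int n"
    obtain d where d: "a = g d" using g(1) by (metis bij_pointE)
    then have dn: "\<bar>d\<bar> \<le> int n" using g(3)[of d] a by force
    then have "\<bar>P x d\<bar> \<le> int n" using abs_P_le_iff[of x d] x(1) by (simp add: C_iff)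
    then have "P z (g d) = g (P x d)" using zb[of d] dn by (simp add: h_le)
    then show "P z a = P y a" using g(4)[OF dn] d by simp
  qed
  then have "y = z" using P_eqI z carr by metis
  then show ?thesis using x y bC by (auto simp: conjugate_in_def z_def)
qed

lemma c_involution:
  assumes kl: "(k, l) \<in> KL_indices n"
  shows "c k l \<in> C" "is_involution G (c k l)"
proof -
  have kln: "2 * k + l \<le> n" using kl by (auto simp: KL_indices_def)
  have "\<bar>P (c k l) (int n + 1)\<bar> = int n + 1"
    using kln by (simp add: P_c[OF kl] swap_pairs_large abs_negate_tail)
  then show "c k l \<in> C" using c_carrier[OF kl] by (simp add: C_iff)
  have "P (c k l) (P (c k l) a) = a" for a
  proof (cases "\<bar>a\<bar> \<le> 2 * int k")
    case True
    then have "\<bar>swap_pairs k a\<bar> \<le> int n - int l" "\<bar>a\<bar> \<le> int n - int l"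
      using abs_swap_pairs_le[OF True] kln by linarith+
    then show ?thesis by (simp add: P_c[OF kl] negate_tail_small swap_pairs_swap_pairs)
  next
    case False
    then show ?thesis
      by (auto simp: P_c[OF kl] swap_pairs_large abs_negate_tail) (auto simp: negate_tail_def)
  qed
  then show "is_involution G (c k l)" using c_carrier[OF kl] is_involution_iff by blast
qed

text \<open>The last set is for the products with \<open>w\<^sub>o\<close>: the sign makes negated
  coordinates out of the fixed ones.\<close>

lemma moved_swap_pairs:
  assumes "2 * k + l \<le> n"
  shows "moved (int n) (\<lambda>a. swap_pairs k (negate_tail n l a)) = {1..2 * int k}"
    "negated (int n) (\<lambda>a. swap_pairs k (negate_tail n l a)) = {int n - int l + 1..int n}"
    "negated (int n) (\<lambda>a. - swap_pairs k (negate_tail n l a)) = {2 * int k + 1..int n - int l}"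
proof -
  have small: "swap_pairs k (negate_tail n l a) = (if odd a then a + 1 else a - 1)"
    if "1 \<le> a" "a \<le> 2 * int k" for a
    using that assms by (simp add: negate_tail_small swap_pairs_pos)
  have large: "swap_pairs k (negate_tail n l a) = (if int n - int l < a then - a else a)"
    if "2 * int k < a" "a \<le> int n" for a
  proof -
    have "swap_pairs k (negate_tail n l a) = negate_tail n l a"
      using that by (intro swap_pairs_large) (simp add: abs_negate_tail)
    then show ?thesis using that by (simp add: negate_tail_def)
  qed
  have small': "\<bar>swap_pairs k (negate_tail n l a)\<bar> \<noteq> a" if "1 \<le> a" "a \<le> 2 * int k" for a
    using small[OF that] that by auto
  have "a \<in> moved (int n) (\<lambda>a. swap_pairs k (negate_tail n l a)) \<longleftrightarrow> a \<in> {1..2 * int k}" for a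
    using small'[of a] large[of a] assms by (cases "a \<le> 2 * int k") (auto simp: moved_def)
  then show "moved (int n) (\<lambda>a. swap_pairs k (negate_tail n l a)) = {1..2 * int k}" by blast
  have "a \<in> negated (int n) (\<lambda>a. swap_pairs k (negate_tail n l a)) \<longleftrightarrow> a \<in> {int n - int l + 1..int n}" for a
    using small'[of a] large[of a] assms by (cases "a \<le> 2 * int k") (auto simp: negated_def split: if_splits)
  then show "negated (int n) (\<lambda>a. swap_pairs k (negate_tail n l a)) = {int n - int l + 1..int n}" by blast
  have "a \<in> negated (int n) (\<lambda>a. - swap_pairs k (negate_tail n l a)) \<longleftrightarrow> a \<in> {2 * int k + 1..int n - int l}" for a
    using small'[of a] large[of a] assms by (cases "a \<le> 2 * int k") (auto simp: negated_def split: if_splits)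
  then show "negated (int n) (\<lambda>a. - swap_pairs k (negate_tail n l a)) = {2 * int k + 1..int n - int l}" by blast
qed

lemma card_c:
  assumes "(k, l) \<in> KL_indices n"
  shows "card (moved (int n) (P (c k l))) = 2 * k" "card (negated (int n) (P (c k l))) = l"
proof -
  have "2 * k + l \<le> n" using assms by (auto simp: KL_indices_def)
  moreover have "P (c k l) = (\<lambda>a. swap_pairs k (negate_tail n l a))" using P_c[OF assms] by blast
  ultimately show "card (moved (int n) (P (c k l))) = 2 * k" "card (negated (int n) (P (c k l))) = l"
    by (simp_all add: moved_swap_pairs)
qed

text \<open>The indices are read off from \<open>x\<close>: \<open>k\<close> is the number of
  exchanged pairs, one ascent for each, and \<open>l\<close> the number of negated coordinates.
  Conjugation preserves both numbers, which gives uniqueness.\<close>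

lemma conjugate_unique_c:
  assumes x: "x \<in> C" "is_involution G x"
  shows "\<exists>!(k, l). (k, l) \<in> KL_indices n \<and> conjugate_in G C x (c k l)"
proof -
  interpret odd_involution "int n" "P x" by (rule involution_P[OF x])
  define k l where "k = card (ascents (int n) (P x))" and "l = card (negated (int n) (P x))"
  have kl: "(k, l) \<in> KL_indices n" using card_sum card_moved by (simp add: KL_indices_iff k_def l_def)
  have "conjugate_in G C x (c k l)"
    using x c_involution[OF kl] card_c[OF kl] card_moved by (intro conjugate_if_card_eq) (simp_all add: k_def l_def)
  then have ex: "(k, l) \<in> KL_indices n \<and> conjugate_in G C x (c k l)" using kl by blast
  have uniq: "k' = k \<and> l' = l" if "(k', l') \<in> KL_indices n" "conjugate_in G C x (c k' l')" for k' l'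
    using conjugate_imp_card_eq[OF that(2)] card_c[OF that(1)] card_moved by (simp add: k_def l_def)
  show ?thesis
  proof (rule ex1I[of _ "(k, l)"])
    show "case (k, l) of (k, l) \<Rightarrow> (k, l) \<in> KL_indices n \<and> conjugate_in G C x (c k l)"
      using ex by (simp only: case_prod_conv)
  next
    fix p assume "case p of (k, l) \<Rightarrow> (k, l) \<in> KL_indices n \<and> conjugate_in G C x (c k l)"
    then show "p = (k, l)" using uniq[of "fst p" "snd p"] by (simp add: case_prod_beta prod_eq_iff)
  qed
qed

text \<open>Multiplication by -1 on 1..n keeps the moved coordinates and exchanges fixed with
  negated ones; \<open>c k l\<close> has n - 2k - l fixed coordinates there.\<close>

lemma conjugate_w\<^sub>o_c:
  assumes kl: "(k, l) \<in> KL_indices n"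
  shows "conjugate_in G C (w\<^sub>o \<otimes>\<^bsub>G\<^esub> c k l) (c k (n - 2 * k - l))"
proof -
  have kln: "2 * k + l \<le> n" using kl by (simp add: KL_indices_iff)
  then have kl': "(k, n - 2 * k - l) \<in> KL_indices n" by (simp add: KL_indices_iff)
  have ck: "c k l \<in> carrier G" "\<bar>P (c k l) (int n + 1)\<bar> = int n + 1"
    using c_involution(1)[OF kl] by (simp_all add: C_iff)
  have PP: "P (w\<^sub>o \<otimes>\<^bsub>G\<^esub> c k l) a = P w\<^sub>o (P (c k l) a)" for a
    using P_mult[OF w\<^sub>o_carrier ck(1)] .
  have on_n: "P (w\<^sub>o \<otimes>\<^bsub>G\<^esub> c k l) a = - swap_pairs k (negate_tail n l a)" if "\<bar>a\<bar> \<le> int n" for a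
    using abs_P_le_iff[OF ck that] by (simp add: PP P_w\<^sub>o P_c[OF kl])
  have m: "moved (int n) (P (w\<^sub>o \<otimes>\<^bsub>G\<^esub> c k l)) = moved (int n) (\<lambda>a. swap_pairs k (negate_tail n l a))"
    "negated (int n) (P (w\<^sub>o \<otimes>\<^bsub>G\<^esub> c k l)) = negated (int n) (\<lambda>a. - swap_pairs k (negate_tail n l a))"
    using on_n by (auto simp: moved_def negated_def)
  have wC: "w\<^sub>o \<in> C" "is_involution G w\<^sub>o"
    using c_involution[of 0 n] by (simp_all add: w\<^sub>o_eq KL_indices_iff)
  have comm: "c k l \<otimes>\<^bsub>G\<^esub> w\<^sub>o = w\<^sub>o \<otimes>\<^bsub>G\<^esub> c k l" using c_involution(1)[OF kl] by (simp add: centralizer_of_def)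
  have "(w\<^sub>o \<otimes>\<^bsub>G\<^esub> c k l) \<otimes>\<^bsub>G\<^esub> (w\<^sub>o \<otimes>\<^bsub>G\<^esub> c k l) = w\<^sub>o \<otimes>\<^bsub>G\<^esub> (c k l \<otimes>\<^bsub>G\<^esub> w\<^sub>o) \<otimes>\<^bsub>G\<^esub> c k l"
    using w\<^sub>o_carrier ck(1) by (simp add: m_assoc)
  also have "\<dots> = (w\<^sub>o \<otimes>\<^bsub>G\<^esub> w\<^sub>o) \<otimes>\<^bsub>G\<^esub> (c k l \<otimes>\<^bsub>G\<^esub> c k l)"
    unfolding comm using w\<^sub>o_carrier ck(1) by (simp add: m_assoc)
  also have "\<dots> = \<one>\<^bsub>G\<^esub>" using wC(2) c_involution(2)[OF kl] by (simp add: is_involution_def)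
  finally have "is_involution G (w\<^sub>o \<otimes>\<^bsub>G\<^esub> c k l)"
    using w\<^sub>o_carrier ck(1) by (simp add: is_involution_def)
  moreover have "w\<^sub>o \<otimes>\<^bsub>G\<^esub> c k l \<in> C" using C_mult wC(1) c_involution(1)[OF kl] by blast
  ultimately show ?thesis
    using c_involution[OF kl'] card_c[OF kl'] kln m
    by (intro conjugate_if_card_eq) (simp_all add: moved_swap_pairs of_nat_diff nat_diff_distrib')
qed

end

theorem mainTheorem4:
  fixes n :: nat
    and W :: "nat list set monoid"
    and w\<^sub>o :: "nat list set"
    and W\<^sub>o :: "nat list set set"
    and c :: "nat \<Rightarrow> nat \<Rightarrow> nat list set"
  assumes "n \<ge> 4" and "even n"
    and "W = W_D (n + 1)"
    and "w\<^sub>o = longest_D (n + 1) (D_nodes (n + 1))"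
    and "W\<^sub>o = centralizer_of W w\<^sub>o"
    and "\<And>k l. c k l = longest_D (n + 1) (I_set n k l)"
  shows "(\<forall>(k, l) \<in> KL_indices n. c k l \<in> W\<^sub>o \<and> is_involution W (c k l)) \<and>
    (\<forall>x \<in> W\<^sub>o. is_involution W x \<longrightarrow>
       (\<exists>!(k, l). (k, l) \<in> KL_indices n \<and> conjugate_in W W\<^sub>o x (c k l))) \<and>
    (\<forall>(k, l) \<in> KL_indices n.
       conjugate_in W W\<^sub>o (w\<^sub>o \<otimes>\<^bsub>W\<^esub> c k l) (c k (n - 2 * k - l)))"
proof -
  interpret D_odd n "n + 1" using assms(1,2) by unfold_locales simp_all
  show ?thesis
    unfolding assms(3-6) using c_involution conjugate_unique_c conjugate_w\<^sub>o_c by blast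
qed

end
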